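(* Let $\varphi \in \mathfrak{M}_0$ have nonzero kernel. Given $f \in \ker \varphi$ with $f \neq 0$ and $r \in (0, \|f\|)$, there exists $\psi \in \mathfrak{M}'_0$ whose kernel is a nonzero nonmaximal ideal of $H^\infty$ such that $\varphi \le \psi$ (pointwise on $H^\infty$) and $\psi(f) = r$.
   Context: $\mathbb{K}$ is an algebraically closed field, complete with respect to a nontrivial nonarchimedean absolute value $|\cdot|$; $\mathbb{D} = \{z \in \mathbb{K} : |z|<1\}$; $\mathbb{N}=\{1,2,\dots\}$. $H^\infty$ is the Banach $\mathbb{K}$-algebra of bounded power series $f(z)=\sum_{n\ge 0} a_n z^n$ on $\mathbb{D}$, with norm $\|f\| = \sup_n |a_n| = \sup_{z\in\mathbb{D}}|f(z)|$. $\mathfrak{M}$ is the Berkovich space of $H^\infty$: the set of all maps $\varphi: H^\infty \to [0,\infty)$ with $\varphi(0)=0$, $\varphi(1)=1$, $\varphi(fg)=\varphi(f)\varphi(g)$, $\varphi(f+g)\le \varphi(f)+\varphi(g)$ and $\varphi(f)\le\|f\|$, with the topology of pointwise convergence (it is compact Hausdorff). $\ker\varphi = \{f : \varphi(f)=0\}$. $D^+(z,r)$ is the closed disk with center $z$ and radius $r$, and for a disk $D\subset\mathbb{D}$, $\zeta_D(f) := \sup_{z\in D}|f(z)|$, which is an element of $\mathfrak{M}$. For an ultrafilter $\mathfrak{u}$ in $\mathbb{N}$, $\lim_{\mathfrak{u}}$ of a sequence in $\mathfrak{M}$ is the (pointwise) limit along $\mathfrak{u}$. $\mathfrak{M}_0$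 is the set of all seminorms $\lim_{\mathfrak{u}} \zeta_{D^+(z_n,r_n)} \in \mathfrak{M}$, where $\mathfrak{u}$ is any nonprincipal ultrafilter in $\mathbb{N}$, $(z_n)$ is any sequence in $\mathbb{D}$ with $\lim_{n\to\infty}|z_n|=1$, and $(r_n)$ is any sequence in $(0,1)$. A sequence $(z_n)$ in $\mathbb{D}$ is regular with respect to $\mathfrak{u}$ if there is $C\in\mathfrak{u}$ with $\inf_{n\in C}\prod_{m\in C, m\ne n}|z_n-z_m|>0$. $\mathfrak{M}'_0\subset \mathfrak{M}_0$ is the set of all such limits $\lim_{\mathfrak{u}} \zeta_{D^+(z_n,r_n)}$ for which, in addition, $(z_n)$ is regular with respect to $\mathfrak{u}$ and, for some $C\in\mathfrak{u}$, the disks $D^+(z_n,r_n)$, $n\in C$, are pairwise disjoint. *)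

theory Defs
  imports "HOL-Analysis.Analysis" "HOL-Algebra.Ideal"
begin

section \<open>The base field\<close>

text \<open>
  The class \<open>real_normed_field\<close> is not usable here: its members contain the archimedean field of
  real numbers. The absolute value is therefore an explicit function on an algebraically
  closed field.
\<close>

locale complete_nonarch_field =
  fixes av :: "'k::alg_closed_field \<Rightarrow> real"
  assumes av_nonneg: "0 \<le> av x"
    and av_eq_0_iff: "av x = 0 \<longleftrightarrow> x = 0"
    and av_mult: "av (x * y) = av x * av y"
    and av_ultrametric: "av (x + y) \<le> max (av x) (av y)"
    and av_nontrivial: "\<exists>x. x \<noteq> 0 \<and> av x \<noteq> 1"
    and av_complete: "Metric_space.mcomplete UNIV (\<lambda>x y. av (x - y))"

definition unit_disk :: "('k::alg_closed_field \<Rightarrow> real) \<Rightarrow> 'k set" where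
  "unit_disk av = {z. av z < 1}"

definition closed_disk :: "('k::alg_closed_field \<Rightarrow> real) \<Rightarrow> 'k \<Rightarrow> real \<Rightarrow> 'k set" where
  "closed_disk av c r = {z. av (z - c) \<le> r}"


section \<open>The algebra of bounded power series\<close>

definition fps_sums_to ::
  "('k::alg_closed_field \<Rightarrow> real) \<Rightarrow> 'k fps \<Rightarrow> 'k \<Rightarrow> 'k \<Rightarrow> bool" where
  "fps_sums_to av f z w \<longleftrightarrow>
     limitin (Metric_space.mtopology UNIV (\<lambda>x y. av (x - y)))
       (\<lambda>N. \<Sum>n<N. fps_nth f n * z ^ n) w sequentially"

definition fps_value :: "('k::alg_closed_field \<Rightarrow> real) \<Rightarrow> 'k fps \<Rightarrow> 'k \<Rightarrow> 'k" where
  "fps_value av f z = (THE w. fps_sums_to av f z w)"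

text \<open>
  Boundedness is expressed through the coefficients. That this is the same as convergence and
  boundedness on the open unit disk, and that the supremum of the coefficients is the supremum
  of the values, is shown in \<open>Hinf_iff_bounded_on_disk\<close> and \<open>Hinf_norm_eq_SUP_disk\<close> below.
\<close>

definition Hinf :: "('k::alg_closed_field \<Rightarrow> real) \<Rightarrow> 'k fps set" where
  "Hinf av = {f. bdd_above (range (\<lambda>n. av (fps_nth f n)))}"

definition Hinf_norm :: "('k::alg_closed_field \<Rightarrow> real) \<Rightarrow> 'k fps \<Rightarrow> real" where
  "Hinf_norm av f = (SUP n. av (fps_nth f n))"

definition Hinf_ring :: "('k::alg_closed_field \<Rightarrow> real) \<Rightarrow> 'k fps ring" where
  "Hinf_ring av = \<lparr>carrier = Hinf av, monoid.mult = (*), one = 1, ring.zero = 0, add = (+)\<rparr>"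


section \<open>The Berkovich space\<close>

text \<open>
  Seminorms are functions on \<open>Hinf av\<close>, encoded as extensional functions on the type of all
  formal power series.
\<close>

definition Berk :: "('k::alg_closed_field \<Rightarrow> real) \<Rightarrow> ('k fps \<Rightarrow> real) set" where
  "Berk av = {\<phi> \<in> Hinf av \<rightarrow>\<^sub>E {0..}.
     \<phi> 0 = 0 \<and> \<phi> 1 = 1 \<and>
     (\<forall>f\<in>Hinf av. \<forall>g\<in>Hinf av. \<phi> (f * g) = \<phi> f * \<phi> g) \<and>
     (\<forall>f\<in>Hinf av. \<forall>g\<in>Hinf av. \<phi> (f + g) \<le> \<phi> f + \<phi> g) \<and>
     (\<forall>f\<in>Hinf av. \<phi> f \<le> Hinf_norm av f)}"

definition Berk_topology ::
  "('k::alg_closed_field \<Rightarrow> real) \<Rightarrow> ('k fps \<Rightarrow> real) topology" where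
  "Berk_topology av =
     subtopology (product_topology (\<lambda>_. euclideanreal) (Hinf av)) (Berk av)"

definition seminorm_kernel ::
  "('k::alg_closed_field \<Rightarrow> real) \<Rightarrow> ('k fps \<Rightarrow> real) \<Rightarrow> 'k fps set" where
  "seminorm_kernel av \<phi> = {f \<in> Hinf av. \<phi> f = 0}"

definition disk_seminorm ::
  "('k::alg_closed_field \<Rightarrow> real) \<Rightarrow> 'k set \<Rightarrow> 'k fps \<Rightarrow> real" where
  "disk_seminorm av D = (\<lambda>f\<in>Hinf av. SUP z\<in>D. av (fps_value av f z))"


section \<open>Limits of disk seminorms along ultrafilters\<close>

text \<open>
  Ultrafilters are filters in the sense of the library: the set \<open>C\<close> belongs to \<open>u\<close> iff
  \<open>eventually (\<lambda>n. n \<in> C) u\<close>.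
\<close>

definition ultrafilter :: "'a filter \<Rightarrow> bool" where
  "ultrafilter u \<longleftrightarrow> u \<noteq> bot \<and> (\<forall>P. eventually P u \<or> eventually (\<lambda>x. \<not> P x) u)"

definition nonprincipal_ultrafilter :: "'a filter \<Rightarrow> bool" where
  "nonprincipal_ultrafilter u \<longleftrightarrow> ultrafilter u \<and> (\<forall>x. u \<noteq> principal {x})"

definition disk_limit_data :: "('k::alg_closed_field \<Rightarrow> real) \<Rightarrow>
    nat filter \<Rightarrow> (nat \<Rightarrow> 'k) \<Rightarrow> (nat \<Rightarrow> real) \<Rightarrow> ('k fps \<Rightarrow> real) \<Rightarrow> bool" where
  "disk_limit_data av u z r \<phi> \<longleftrightarrow>
     nonprincipal_ultrafilter u \<and>
     (\<forall>n. z n \<in> unit_disk av) \<and> (\<lambda>n. av (z n)) \<longlonglongrightarrow> 1 \<and>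
     (\<forall>n. 0 < r n \<and> r n < 1) \<and>
     limitin (Berk_topology av) (\<lambda>n. disk_seminorm av (closed_disk av (z n) (r n))) \<phi> u"

definition Berk0 :: "('k::alg_closed_field \<Rightarrow> real) \<Rightarrow> ('k fps \<Rightarrow> real) set" where
  "Berk0 av = {\<phi>. \<exists>u z r. disk_limit_data av u z r \<phi>}"

text \<open>
  The product of the distances from \<open>z n\<close> is the limit of its partial products, which exists
  because all factors lie in the unit interval. The library's \<open>prodinf\<close> is not suitable: an
  infinite product whose partial products tend to \<open>0\<close> does not count as convergent there.
\<close>

definition separation ::
  "('k::alg_closed_field \<Rightarrow> real) \<Rightarrow> (nat \<Rightarrow> 'k) \<Rightarrow> nat set \<Rightarrow> nat \<Rightarrow> real" where
  "separation av z C n = lim (\<lambda>N. \<Prod>m | m < N \<and> m \<in> C \<and> m \<noteq> n. av (z n - z m))"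

definition regular_wrt ::
  "('k::alg_closed_field \<Rightarrow> real) \<Rightarrow> (nat \<Rightarrow> 'k) \<Rightarrow> nat filter \<Rightarrow> bool" where
  "regular_wrt av z u \<longleftrightarrow>
     (\<exists>C. eventually (\<lambda>n. n \<in> C) u \<and> (INF n\<in>C. separation av z C n) > 0)"

definition Berk0' :: "('k::alg_closed_field \<Rightarrow> real) \<Rightarrow> ('k fps \<Rightarrow> real) set" where
  "Berk0' av = {\<phi>. \<exists>u z r. disk_limit_data av u z r \<phi> \<and> regular_wrt av z u \<and>
     (\<exists>C. eventually (\<lambda>n. n \<in> C) u \<and>
        disjoint_family_on (\<lambda>n. closed_disk av (z n) (r n)) C)}"


section \<open>Consistency of the definitions\<close>

context complete_nonarch_field
begin

lemma av_1: "av 1 = 1"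
  using av_mult[of 1 1] av_eq_0_iff[of 1] by simp

lemma av_0: "av 0 = 0"
  by (simp add: av_eq_0_iff)

lemma av_minus: "av (- x) = av x"
proof -
  have "av (-1) * av (-1) = 1"
    using av_mult[of "-1" "-1"] by (simp add: av_1)
  hence "av (-1) = 1"
    using av_nonneg[of "-1"] by (auto simp: square_eq_1_iff)
  thus ?thesis
    using av_mult[of "-1" x] by simp
qed

lemma av_minus_commute: "av (x - y) = av (y - x)"
  using av_minus[of "x - y"] by simp

lemma av_diff_le: "av (x - y) \<le> max (av x) (av y)"
  using av_ultrametric[of x "- y"] by (simp add: av_minus)

lemma av_power: "av (x ^ n) = av x ^ n"
  by (induction n) (auto simp: av_1 av_mult)

lemma av_sum_le:
  assumes "\<And>i. i \<in> A \<Longrightarrow> av (g i) \<le> B" "0 \<le> B"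
  shows "av (sum g A) \<le> B"
  using assms
proof (induction A rule: infinite_finite_induct)
  case (insert x F)
  have "av (sum g (insert x F)) \<le> max (av (g x)) (av (sum g F))"
    using insert.hyps by (simp add: av_ultrametric)
  also have "\<dots> \<le> B"
    using insert by simp
  finally show ?case .
qed (auto simp: av_0)

sublocale Metric_space UNIV "\<lambda>x y. av (x - y)"
proof
  show "av (x - z) \<le> av (x - y) + av (y - z)" for x y z
    using av_ultrametric[of "x - y" "y - z"] av_nonneg[of "x - y"] av_nonneg[of "y - z"]
    by (simp add: max_def split: if_splits)
qed (auto simp: av_nonneg av_minus_commute av_eq_0_iff)

lemma fps_sums_to_iff:
  "fps_sums_to av f z w \<longleftrightarrow>
     (\<forall>\<epsilon>>0. \<exists>N. \<forall>n\<ge>N. av ((\<Sum>k<n. fps_nth f k * z ^ k) - w) < \<epsilon>)"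
  by (simp add: fps_sums_to_def limit_metric_sequentially)

lemma fps_sums_to_unique:
  "fps_sums_to av f z w \<Longrightarrow> fps_sums_to av f z w' \<Longrightarrow> w = w'"
  unfolding fps_sums_to_def
  by (rule limitin_metric_unique) auto

lemma fps_value_eqI: "fps_sums_to av f z w \<Longrightarrow> fps_value av f z = w"
  unfolding fps_value_def using fps_sums_to_unique by blast

lemma fps_sums_to_if_terms_null:
  assumes "(\<lambda>n. av (fps_nth f n * z ^ n)) \<longlonglongrightarrow> 0"
  shows "\<exists>w. fps_sums_to av f z w"
proof -
  define S where "S N = (\<Sum>n<N. fps_nth f n * z ^ n)" for N
  have "MCauchy S"
    unfolding MCauchy_def
  proof (intro conjI allI impI)
    fix \<epsilon> :: real assume "\<epsilon> > 0"
    then obtain N where N: "\<And>n. n \<ge> N \<Longrightarrow> av (fps_nth f n * z ^ n) < \<epsilon> / 2"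
      using LIMSEQ_D[OF assms, of "\<epsilon> / 2"] by (auto simp: av_nonneg)
    have *: "av (S n' - S n) < \<epsilon>" if "N \<le> n" "n \<le> n'" for n n'
    proof -
      have "S n' - S n = (\<Sum>k\<in>{n..<n'}. fps_nth f k * z ^ k)"
        unfolding S_def using that(2) by (simp add: sum_diff_nat_ivl[of 0] lessThan_atLeast0)
      also have "av \<dots> \<le> \<epsilon> / 2"
        using that N \<open>\<epsilon> > 0\<close> by (intro av_sum_le) (auto intro: less_imp_le)
      finally show ?thesis using \<open>\<epsilon> > 0\<close> by simp
    qed
    show "\<exists>N. \<forall>n n'. N \<le> n \<longrightarrow> N \<le> n' \<longrightarrow> av (S n - S n') < \<epsilon>"
      using * by (metis av_minus_commute nat_le_linear)
  qed auto
  thus ?thesis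
    using av_complete unfolding mcomplete_def fps_sums_to_def S_def by blast
qed

lemma fps_terms_null_if_sums_to:
  assumes "fps_sums_to av f z w"
  shows "(\<lambda>n. av (fps_nth f n * z ^ n)) \<longlonglongrightarrow> 0"
proof (rule LIMSEQ_I)
  fix \<epsilon> :: real assume "\<epsilon> > 0"
  then obtain N where N: "\<And>n. n \<ge> N \<Longrightarrow> av ((\<Sum>k<n. fps_nth f k * z ^ k) - w) < \<epsilon>"
    using assms by (auto simp: fps_sums_to_iff)
  have "av (fps_nth f n * z ^ n) < \<epsilon>" if "n \<ge> N" for n
    using av_diff_le[of "(\<Sum>k<Suc n. fps_nth f k * z ^ k) - w" "(\<Sum>k<n. fps_nth f k * z ^ k) - w"]
      N[of n] N[of "Suc n"] that by simp
  thus "\<exists>N. \<forall>n\<ge>N. norm (av (fps_nth f n * z ^ n) - 0) < \<epsilon>"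
    by (auto simp: av_nonneg)
qed

lemma fps_sums_to_tail_le:
  assumes "fps_sums_to av f z w" "\<And>k. k \<ge> K \<Longrightarrow> av (fps_nth f k * z ^ k) \<le> B"
  shows "av (w - (\<Sum>k<K. fps_nth f k * z ^ k)) \<le> B"
proof (rule field_le_epsilon)
  fix \<epsilon> :: real assume "\<epsilon> > 0"
  then obtain N where N: "\<And>n. n \<ge> N \<Longrightarrow> av ((\<Sum>k<n. fps_nth f k * z ^ k) - w) < \<epsilon>"
    using assms(1) by (auto simp: fps_sums_to_iff)
  define n where "n = max N K"
  have "0 \<le> B"
    using assms(2)[of K] av_nonneg[of "fps_nth f K * z ^ K"] by simp
  have "(\<Sum>k<n. fps_nth f k * z ^ k) - (\<Sum>k<K. fps_nth f k * z ^ k) =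
          (\<Sum>k\<in>{K..<n}. fps_nth f k * z ^ k)"
    unfolding n_def by (simp add: sum_diff_nat_ivl[of 0] lessThan_atLeast0)
  hence 1: "av ((\<Sum>k<n. fps_nth f k * z ^ k) - (\<Sum>k<K. fps_nth f k * z ^ k)) \<le> B"
    using assms(2) \<open>0 \<le> B\<close> by (auto intro!: av_sum_le)
  have 2: "av ((\<Sum>k<n. fps_nth f k * z ^ k) - w) < \<epsilon>"
    using N[of n] by (simp add: n_def)
  show "av (w - (\<Sum>k<K. fps_nth f k * z ^ k)) \<le> B + \<epsilon>"
    using 1 2 \<open>0 \<le> B\<close> \<open>\<epsilon> > 0\<close>
      av_diff_le[of "(\<Sum>k<n. fps_nth f k * z ^ k) - (\<Sum>k<K. fps_nth f k * z ^ k)"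
        "(\<Sum>k<n. fps_nth f k * z ^ k) - w"]
    by simp
qed

lemma av_of_nat_le: "av (of_nat n) \<le> 1"
proof -
  have "av (\<Sum>i<n. 1) \<le> 1" by (rule av_sum_le) (auto simp: av_1)
  thus ?thesis by simp
qed

lemma ex_av_of_nat_eq_1: "\<exists>N\<ge>m. av (of_nat N) = 1"
proof (rule ccontr)
  assume "\<not> ?thesis"
  hence "av (of_nat m) < 1" "av (of_nat (Suc m)) < 1"
    using av_of_nat_le[of m] av_of_nat_le[of "Suc m"] by (auto simp: less_le simp del: of_nat_Suc)
  thus False
    using av_diff_le[of "of_nat (Suc m)" "of_nat m"] by (simp add: av_1)
qed

lemma finite_roots_of_unity:
  assumes "k > 0"
  shows "finite {x :: 'k. x ^ k = 1}" "card {x :: 'k. x ^ k = 1} \<le> k"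
proof -
  define p :: "'k poly" where "p = monom 1 k - 1"
  have p: "{x. poly p x = 0} = {x. x ^ k = 1}"
    by (simp add: p_def poly_monom)
  have "coeff p k = 1" using assms by (simp add: p_def)
  hence "p \<noteq> 0" by auto
  have "degree p \<le> k"
    unfolding p_def by (intro degree_diff_le) (auto simp: degree_monom_le)
  thus "finite {x :: 'k. x ^ k = 1}" "card {x :: 'k. x ^ k = 1} \<le> k"
    using poly_roots_finite[OF \<open>p \<noteq> 0\<close>] card_poly_roots_bound[OF \<open>p \<noteq> 0\<close>] by (auto simp: p)
qed

lemma card_roots_of_unity:
  assumes "av (of_nat N) = 1"
  shows "card {x :: 'k. x ^ N = 1} = N"
proof -
  have N: "N > 0" "(of_nat N :: 'k) \<noteq> 0"
    using assms by (auto simp: av_0 intro: gr0I)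
  define p :: "'k poly" where "p = monom 1 N - 1"
  have poly_p: "poly p x = x ^ N - 1" for x
    by (simp add: p_def poly_monom)
  have "coeff p N = 1" using N by (simp add: p_def)
  hence "p \<noteq> 0" by auto
  have "degree p \<le> N"
    unfolding p_def by (intro degree_diff_le) (auto simp: degree_monom_le)
  hence deg: "degree p = N"
    using \<open>coeff p N = 1\<close> le_degree[of p N] by simp
  have order_le: "Polynomial.order x p \<le> 1" for x
  proof (rule ccontr)
    assume "\<not> Polynomial.order x p \<le> 1"
    hence "[:-x, 1:] ^ 2 dvd p"
      using \<open>p \<noteq> 0\<close> by (subst order_divides) auto
    then obtain q where "p = [:-x, 1:] ^ 2 * q"
      by (elim dvdE)
    hence q: "p = [:-x, 1:] * ([:-x, 1:] * q)"
      by (simp only: power2_eq_square mult.assoc)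
    have "poly p x = 0" "poly (pderiv p) x = 0"
      by (simp_all only: q pderiv_mult poly_mult poly_add) simp_all
    thus False
      using N by (auto simp: poly_p p_def pderiv_diff pderiv_monom poly_monom power_0_left)
  qed
  obtain A where A: "size A = degree p" "p = smult (lead_coeff p) (\<Prod>x\<in>#A. [:-x, 1:])"
    using alg_closed_imp_factorization[OF \<open>p \<noteq> 0\<close>] by blast
  have "proots p = proots (\<Prod>x\<in>#A. [:-x, 1:])"
    using A(2) \<open>p \<noteq> 0\<close> by (metis leading_coeff_0_iff proots_smult)
  also have "\<dots> = A"
  proof (induction A)
    case (add x A)
    have "(\<Prod>x\<in>#A. [:-x, 1:]) \<noteq> 0"
      by (auto simp: prod_mset_zero_iff)
    thus ?case
      using add.IH by (simp add: proots_mult del: mult_pCons_left)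
  qed simp
  finally have A_eq: "proots p = A" .
  have "count A x = (if x \<in> {x. poly p x = 0} then 1 else 0)" for x
    using order_le[of x] \<open>p \<noteq> 0\<close> order_root[of p x] unfolding A_eq[symmetric] by auto
  hence "A = mset_set {x. poly p x = 0}"
    using poly_roots_finite[OF \<open>p \<noteq> 0\<close>] by (intro multiset_eqI) simp
  hence "size A = card {x. poly p x = 0}" by simp
  thus ?thesis using A(1) deg by (simp add: poly_p)
qed

lemma sum_roots_of_unity:
  assumes "av (of_nat N) = 1" "0 < k" "k < N"
  shows "(\<Sum>\<omega> | \<omega> ^ N = 1. \<omega> ^ k) = (0 :: 'k)"
proof -
  define U where "U = {\<omega> :: 'k. \<omega> ^ N = 1}"
  have "finite U" "card U = N"
    using finite_roots_of_unity[of N] card_roots_of_unity[OF assms(1)] assms by (auto simp: U_def)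
  have "\<not> U \<subseteq> {\<omega>. \<omega> ^ k = 1}"
    using card_mono[of "{\<omega> :: 'k. \<omega> ^ k = 1}" U] finite_roots_of_unity[of k] assms \<open>card U = N\<close>
    by auto
  then obtain \<zeta> :: 'k where \<zeta>: "\<zeta> ^ N = 1" "\<zeta> ^ k \<noteq> 1"
    by (auto simp: U_def)
  have "\<zeta> \<noteq> 0" using \<zeta> assms by (auto simp: power_0_left)
  have "bij_betw ((*) \<zeta>) U U"
    using \<zeta> \<open>\<zeta> \<noteq> 0\<close>
    by (intro bij_betwI[where g = "\<lambda>x. x / \<zeta>"]) (auto simp: U_def power_mult_distrib power_divide)
  hence "(\<Sum>\<omega>\<in>U. \<omega> ^ k) = (\<Sum>\<omega>\<in>U. (\<zeta> * \<omega>) ^ k)"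
    by (rule sum.reindex_bij_betw[symmetric])
  also have "\<dots> = \<zeta> ^ k * (\<Sum>\<omega>\<in>U. \<omega> ^ k)"
    by (simp add: power_mult_distrib sum_distrib_left)
  finally show ?thesis using \<zeta> by (simp add: U_def)
qed

lemma av_coeff_le_if_values_le:
  assumes conv: "\<And>\<omega>. av \<omega> = 1 \<Longrightarrow> \<exists>w. fps_sums_to av f (\<omega> * z) w \<and> av w \<le> B"
  shows "av (fps_nth f n * z ^ n) \<le> B"
proof (rule field_le_epsilon)
  fix \<epsilon> :: real assume "\<epsilon> > 0"
  obtain w0 where w0: "fps_sums_to av f z w0" "av w0 \<le> B"
    using conv[of 1] by (auto simp: av_1)
  have "B \<ge> 0" using w0(2) av_nonneg[of w0] by simp
  obtain K where K: "\<And>k. k \<ge> K \<Longrightarrow> av (fps_nth f k * z ^ k) < \<epsilon>"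
    using LIMSEQ_D[OF fps_terms_null_if_sums_to[OF w0(1)] \<open>\<epsilon> > 0\<close>] by (auto simp: av_nonneg)
  obtain N where N: "N \<ge> max K (Suc n)" "av (of_nat N) = 1"
    using ex_av_of_nat_eq_1 by blast
  define U where "U = {\<omega> :: 'k. \<omega> ^ N = 1}"
  have U: "finite U" "card U = N"
    using finite_roots_of_unity[of N] card_roots_of_unity[OF N(2)] N(1) by (auto simp: U_def)
  have av_U: "av \<omega> = 1" if "\<omega> \<in> U" for \<omega>
  proof -
    have "av \<omega> ^ N = 1" using that by (simp add: U_def av_1 flip: av_power)
    thus ?thesis using power_eq_imp_eq_base[of "av \<omega>" N 1] N(1) av_nonneg[of \<omega>] by simp
  qed
  have bd: "av (\<Sum>k<N. fps_nth f k * (\<omega> * z) ^ k) \<le> B + \<epsilon>" if "\<omega> \<in> U" for \<omega>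
  proof -
    obtain w where w: "fps_sums_to av f (\<omega> * z) w" "av w \<le> B"
      using conv av_U[OF \<open>\<omega> \<in> U\<close>] by blast
    have "av (w - (\<Sum>k<N. fps_nth f k * (\<omega> * z) ^ k)) \<le> \<epsilon>"
      using w(1)
    proof (rule fps_sums_to_tail_le)
      fix k assume "k \<ge> N"
      thus "av (fps_nth f k * (\<omega> * z) ^ k) \<le> \<epsilon>"
        using K[of k] N(1) av_U[OF that] by (simp add: av_mult av_power)
    qed
    thus ?thesis
      using av_diff_le[of w "w - (\<Sum>k<N. fps_nth f k * (\<omega> * z) ^ k)"] w(2) \<open>\<epsilon> > 0\<close> \<open>B \<ge> 0\<close> by simp
  qed
  have sum0: "(\<Sum>\<omega>\<in>U. \<omega> ^ (N - n + k)) = (if k = n then of_nat N else 0)" if "k < N" for k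
  proof (cases k n rule: linorder_cases)
    case less
    hence "N - n + k < N" "0 < N - n + k" using N(1) by linarith+
    thus ?thesis
      using sum_roots_of_unity[OF N(2), of "N - n + k"] less unfolding U_def by presburger
  next
    case equal
    thus ?thesis using U N(1) by (simp add: U_def)
  next
    case greater
    have "(\<Sum>\<omega>\<in>U. \<omega> ^ (N - n + k)) = (\<Sum>\<omega>\<in>U. \<omega> ^ N * \<omega> ^ (k - n))"
      using greater N(1) by (intro sum.cong) (auto simp flip: power_add)
    also have "\<dots> = (\<Sum>\<omega>\<in>U. \<omega> ^ (k - n))"
      by (intro sum.cong) (auto simp: U_def)
    finally show ?thesis
      using sum_roots_of_unity[OF N(2), of "k - n"] greater that by (simp add: U_def)
  qed
  have "(\<Sum>\<omega>\<in>U. \<omega> ^ (N - n) * (\<Sum>k<N. fps_nth f k * (\<omega> * z) ^ k)) =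
        (\<Sum>\<omega>\<in>U. \<Sum>k<N. fps_nth f k * z ^ k * \<omega> ^ (N - n + k))"
    by (simp add: sum_distrib_left power_mult_distrib power_add mult_ac)
  also have "\<dots> = (\<Sum>k<N. fps_nth f k * z ^ k * (\<Sum>\<omega>\<in>U. \<omega> ^ (N - n + k)))"
    by (subst sum.swap) (simp add: sum_distrib_left)
  also have "\<dots> = (\<Sum>k<N. if k = n then fps_nth f k * z ^ k * of_nat N else 0)"
    by (intro sum.cong) (auto simp: sum0)
  also have "\<dots> = fps_nth f n * z ^ n * of_nat N"
    using N(1) by simp
  finally have eq: "fps_nth f n * z ^ n * of_nat N =
      (\<Sum>\<omega>\<in>U. \<omega> ^ (N - n) * (\<Sum>k<N. fps_nth f k * (\<omega> * z) ^ k))" by simp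
  have "av (fps_nth f n * z ^ n) = av (fps_nth f n * z ^ n * of_nat N)"
    using N(2) by (simp add: av_mult)
  also have "\<dots> \<le> B + \<epsilon>"
    unfolding eq using bd av_U \<open>B \<ge> 0\<close> \<open>\<epsilon> > 0\<close>
    by (intro av_sum_le) (auto simp: av_mult[of "_ ^ (N - n)"] av_power[of _ "N - n"])
  finally show "av (fps_nth f n * z ^ n) \<le> B + \<epsilon>" .
qed

lemma ex_av_between:
  assumes "c < 1"
  shows "\<exists>z. c < av z \<and> av z < 1"
proof -
  obtain x where x: "x \<noteq> 0" "av x < 1"
  proof -
    obtain y where y: "y \<noteq> 0" "av y \<noteq> 1" using av_nontrivial by blast
    have "av y * av (inverse y) = 1"
      using y(1) by (simp add: av_1 flip: av_mult)
    hence "av y < 1 \<or> av (inverse y) < 1"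
      using y(2) by (smt (verit) av_nonneg mult_less_cancel_left2 mult_cancel_left2)
    thus ?thesis using that y(1) by (metis inverse_nonzero_iff_nonzero)
  qed
  have "av x > 0" using x av_nonneg[of x] av_eq_0_iff[of x] by linarith
  have "(\<lambda>n. root n (av x)) \<longlonglongrightarrow> 1"
    using \<open>av x > 0\<close> by (rule LIMSEQ_root_const)
  hence "eventually (\<lambda>n. root n (av x) > c) sequentially"
    using assms by (rule order_tendstoD)
  hence "eventually (\<lambda>n. root n (av x) > c \<and> n > 0) sequentially"
    by (intro eventually_conj eventually_gt_at_top)
  then obtain n where n: "root n (av x) > c" "n > 0"
    using eventually_happens'[OF sequentially_bot] by blast
  obtain z where z: "z ^ n = x" using nth_root_exists[OF n(2)] by blast
  have "root n (av x) = av z"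
    using n(2) z av_nonneg[of z] by (metis av_power real_root_power_cancel)
  moreover have "root n (av x) < 1"
    using n(2) x by simp
  ultimately show ?thesis using n(1) by auto
qed

lemma av_coeff_le_if_disk_values_le:
  assumes "\<And>z. z \<in> unit_disk av \<Longrightarrow> \<exists>w. fps_sums_to av f z w \<and> av w \<le> B"
  shows "av (fps_nth f n) \<le> B"
proof (rule ccontr)
  assume "\<not> ?thesis"
  hence gt: "B < av (fps_nth f n)" by simp
  have "B \<ge> 0"
  proof -
    obtain w where "av w \<le> B"
      using assms[of 0] by (auto simp: unit_disk_def av_0)
    thus ?thesis using av_nonneg[of w] by linarith
  qed
  define c where "c = root (Suc n) (B / av (fps_nth f n))"
  have "0 \<le> c" "c < 1"
    using gt \<open>B \<ge> 0\<close> by (auto simp: c_def)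
  then obtain z where z: "c < av z" "av z < 1" using ex_av_between by blast
  have "B / av (fps_nth f n) = c ^ Suc n"
    unfolding c_def using gt \<open>B \<ge> 0\<close> by (intro real_root_pow_pos2[symmetric]) auto
  also have "\<dots> < av z ^ Suc n"
    using z \<open>0 \<le> c\<close> by (intro power_strict_mono) auto
  also have "\<dots> \<le> av z ^ n"
    using z av_nonneg[of z] by (intro power_decreasing) auto
  finally have "B < av (fps_nth f n * z ^ n)"
    using gt \<open>B \<ge> 0\<close> by (simp add: divide_less_eq av_mult av_power mult.commute)
  moreover have "av (fps_nth f n * z ^ n) \<le> B"
    using z(2) by (intro av_coeff_le_if_values_le assms) (simp add: unit_disk_def av_mult)
  ultimately show False by simp
qed

lemma av_coeff_le_norm: "f \<in> Hinf av \<Longrightarrow> av (fps_nth f n) \<le> Hinf_norm av f"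
  unfolding Hinf_def Hinf_norm_def by (auto intro: cSUP_upper)

lemma Hinf_sums_to:
  assumes "f \<in> Hinf av" "z \<in> unit_disk av"
  shows "fps_sums_to av f z (fps_value av f z)" "av (fps_value av f z) \<le> Hinf_norm av f"
proof -
  define B where "B = Hinf_norm av f"
  have B: "av (fps_nth f n) \<le> B" for n
    using av_coeff_le_norm[OF assms(1)] by (simp add: B_def)
  have "B \<ge> 0" using B[of 0] av_nonneg[of "fps_nth f 0"] by simp
  have z: "av z < 1" "0 \<le> av z" using assms(2) av_nonneg by (auto simp: unit_disk_def)
  have "(\<lambda>n. av (fps_nth f n * z ^ n)) \<longlonglongrightarrow> 0"
  proof (rule tendsto_sandwich[where f = "\<lambda>_. 0" and h = "\<lambda>n. B * av z ^ n"])
    show "(\<lambda>n. B * av z ^ n) \<longlonglongrightarrow> 0"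
      using z by (intro tendsto_mult_right_zero LIMSEQ_power_zero) auto
    show "\<forall>\<^sub>F n in sequentially. av (fps_nth f n * z ^ n) \<le> B * av z ^ n"
      using B z by (auto simp: av_mult av_power intro!: always_eventually mult_right_mono)
  qed (auto simp: av_nonneg)
  then obtain w where w: "fps_sums_to av f z w"
    using fps_sums_to_if_terms_null by blast
  thus sums: "fps_sums_to av f z (fps_value av f z)"
    using fps_value_eqI by simp
  have "av (fps_nth f n * z ^ n) \<le> B" for n
  proof -
    have "av (fps_nth f n) * av z ^ n \<le> B * 1"
      using B z \<open>B \<ge> 0\<close> by (intro mult_mono power_le_one) auto
    thus ?thesis by (simp add: av_mult av_power)
  qed
  thus "av (fps_value av f z) \<le> Hinf_norm av f"
    using fps_sums_to_tail_le[OF sums, of 0] by (simp add: B_def)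
qed

theorem Hinf_iff_bounded_on_disk:
  "f \<in> Hinf av \<longleftrightarrow>
     (\<forall>z\<in>unit_disk av. \<exists>w. fps_sums_to av f z w) \<and>
     bdd_above ((\<lambda>z. av (fps_value av f z)) ` unit_disk av)"
proof
  assume "f \<in> Hinf av"
  thus "(\<forall>z\<in>unit_disk av. \<exists>w. fps_sums_to av f z w) \<and>
     bdd_above ((\<lambda>z. av (fps_value av f z)) ` unit_disk av)"
    using Hinf_sums_to[of f] by (auto intro!: bdd_aboveI2[where M = "Hinf_norm av f"])
next
  assume *: "(\<forall>z\<in>unit_disk av. \<exists>w. fps_sums_to av f z w) \<and>
     bdd_above ((\<lambda>z. av (fps_value av f z)) ` unit_disk av)"
  then obtain B where "\<And>z. z \<in> unit_disk av \<Longrightarrow> av (fps_value av f z) \<le> B"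
    by (auto simp: bdd_above_def)
  hence "av (fps_nth f n) \<le> B" for n
    using * fps_value_eqI by (intro av_coeff_le_if_disk_values_le) metis
  thus "f \<in> Hinf av"
    by (auto simp: Hinf_def intro!: bdd_aboveI2[where M = B])
qed

theorem Hinf_norm_eq_SUP_disk:
  assumes "f \<in> Hinf av"
  shows "Hinf_norm av f = (SUP z\<in>unit_disk av. av (fps_value av f z))"
proof (rule antisym)
  have bdd: "bdd_above ((\<lambda>z. av (fps_value av f z)) ` unit_disk av)"
    using assms Hinf_iff_bounded_on_disk[of f] by simp
  have "av (fps_nth f n) \<le> (SUP z\<in>unit_disk av. av (fps_value av f z))" for n
    using Hinf_sums_to(1)[OF assms]
    by (intro av_coeff_le_if_disk_values_le) (auto intro: cSUP_upper[OF _ bdd])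
  thus "Hinf_norm av f \<le> (SUP z\<in>unit_disk av. av (fps_value av f z))"
    unfolding Hinf_norm_def by (intro cSUP_least) auto
  have "0 \<in> unit_disk av" by (simp add: unit_disk_def av_0)
  thus "(SUP z\<in>unit_disk av. av (fps_value av f z)) \<le> Hinf_norm av f"
    using Hinf_sums_to(2)[OF assms] by (intro cSUP_least) auto
qed

lemma Hinf_add: "f \<in> Hinf av \<Longrightarrow> g \<in> Hinf av \<Longrightarrow> f + g \<in> Hinf av"
  unfolding Hinf_def mem_Collect_eq
proof (elim bdd_above.E)
  fix A B assume AB: "\<And>x. x \<in> range (\<lambda>n. av (fps_nth f n)) \<Longrightarrow> x \<le> A"
    "\<And>x. x \<in> range (\<lambda>n. av (fps_nth g n)) \<Longrightarrow> x \<le> B"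
  show "bdd_above (range (\<lambda>n. av (fps_nth (f + g) n)))"
  proof (rule bdd_aboveI2)
    fix n
    have "av (fps_nth (f + g) n) \<le> max (av (fps_nth f n)) (av (fps_nth g n))"
      by (simp add: av_ultrametric)
    also have "\<dots> \<le> max A B"
      using AB by (intro max.mono) auto
    finally show "av (fps_nth (f + g) n) \<le> max A B" .
  qed
qed

lemma Hinf_mult:
  assumes "f \<in> Hinf av" "g \<in> Hinf av"
  shows "f * g \<in> Hinf av"
  unfolding Hinf_def mem_Collect_eq
proof (rule bdd_aboveI2)
  fix n
  have nonneg: "0 \<le> Hinf_norm av f" "0 \<le> Hinf_norm av g"
    using av_coeff_le_norm[OF assms(1), of 0] av_coeff_le_norm[OF assms(2), of 0] av_nonneg
    by (meson order_trans)+
  show "av (fps_nth (f * g) n) \<le> Hinf_norm av f * Hinf_norm av g"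
    unfolding fps_mult_nth using av_coeff_le_norm assms nonneg
    by (intro av_sum_le) (auto simp: av_mult av_nonneg intro!: mult_mono)
qed

lemma Hinf_uminus: "f \<in> Hinf av \<Longrightarrow> - f \<in> Hinf av"
  by (simp add: Hinf_def av_minus)

lemma Hinf_0: "0 \<in> Hinf av"
  by (simp add: Hinf_def av_0)

lemma Hinf_1: "1 \<in> Hinf av"
  unfolding Hinf_def mem_Collect_eq
  by (rule bdd_aboveI2[where M = 1]) (auto simp: av_0 av_1)

theorem cring_Hinf: "cring (Hinf_ring av)"
proof (rule cringI)
  show "abelian_group (Hinf_ring av)"
  proof (rule abelian_groupI)
    fix f assume "f \<in> carrier (Hinf_ring av)"
    thus "\<exists>g\<in>carrier (Hinf_ring av). g \<oplus>\<^bsub>Hinf_ring av\<^esub> f = \<zero>\<^bsub>Hinf_ring av\<^esub>"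
      by (intro bexI[of _ "- f"]) (auto simp: Hinf_ring_def Hinf_uminus)
  qed (auto simp: Hinf_ring_def Hinf_add Hinf_0 add_ac)
  show "comm_monoid (Hinf_ring av)"
    by (rule comm_monoidI) (auto simp: Hinf_ring_def Hinf_mult Hinf_1 mult_ac)
qed (auto simp: Hinf_ring_def algebra_simps)

theorem separation_tendsto:
  assumes "\<And>m. z m \<in> unit_disk av"
  shows "(\<lambda>N. \<Prod>m | m < N \<and> m \<in> C \<and> m \<noteq> n. av (z n - z m)) \<longlonglongrightarrow> separation av z C n"
proof -
  define P where "P N = (\<Prod>m | m < N \<and> m \<in> C \<and> m \<noteq> n. av (z n - z m))" for N
  have le1: "av (z n - z m) \<le> 1" for m
    using av_diff_le[of "z n" "z m"] assms[of n] assms[of m] by (simp add: unit_disk_def)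
  have nonneg: "0 \<le> P N" for N
    unfolding P_def by (intro prod_nonneg) (auto simp: av_nonneg)
  have "P (Suc N) \<le> P N" for N
  proof (cases "N \<in> C \<and> N \<noteq> n")
    case True
    hence "{m. m < Suc N \<and> m \<in> C \<and> m \<noteq> n} = insert N {m. m < N \<and> m \<in> C \<and> m \<noteq> n}"
      by auto
    hence "P (Suc N) = av (z n - z N) * P N"
      by (simp add: P_def)
    thus ?thesis using le1[of N] nonneg[of N] av_nonneg by (simp add: mult_left_le_one_le)
  next
    case False
    hence "{m. m < Suc N \<and> m \<in> C \<and> m \<noteq> n} = {m. m < N \<and> m \<in> C \<and> m \<noteq> n}"
      by (auto simp: less_Suc_eq)
    thus ?thesis by (simp add: P_def)
  qed
  hence "decseq P" by (rule decseq_SucI)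
  then obtain L where "P \<longlonglongrightarrow> L"
    using decseq_convergent[of P 0] nonneg by blast
  hence "convergent P" by (rule convergentI)
  thus ?thesis
    unfolding separation_def P_def[symmetric, abs_def] by (simp add: convergent_LIMSEQ_iff)
qed

end

end

theory Submission
  imports Defs
begin

text \<open>
  Write \<open>\<zeta>(D)\<close> for the supremum seminorm of a disk \<open>D\<close>. Let \<open>\<phi>\<close> be the limit of the
  \<open>\<zeta>(D(z n, t n))\<close> along \<open>u\<close>, with \<open>\<phi> f = 0\<close>. For \<open>u\<close>-almost all \<open>n\<close> the supremum of \<open>f\<close> on
  \<open>D(z n, t n)\<close> is less than \<open>r\<close>. As the radius grows to \<open>1\<close>, this supremum increases continuously to
  the norm of \<open>f\<close>, which exceeds \<open>r\<close>, so there is a largest radius \<open>s n\<close> at which it equals \<open>r\<close>. The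
  limit \<open>\<psi>\<close> of the \<open>\<zeta>(D(z n, s n))\<close> dominates \<open>\<phi>\<close> and satisfies \<open>\<psi> f = r\<close>. Its kernel is
  properly contained in the proper ideal \<open>ker \<phi>\<close>, because \<open>f\<close> lies in the latter only; hence it is
  not maximal. Two things remain.

  The limit has the required shape: maximality of the radii makes two of the disks \<open>D(z n, s n)\<close>
  equal or disjoint, and only finitely many of them coincide with a given one because the centres tend
  to the boundary. Replacing every index by a representative of its disk, and \<open>u\<close> by its image, makes
  the disks disjoint (\<open>disjoint_reindexing\<close>). Moreover \<open>f\<close> must have a zero in each disk, since its
  supremum starts to grow there. Comparing the supremum \<open>r\<close> of \<open>f\<close> on disk \<open>n\<close> with the norm of \<open>f\<close>,
  zero by zero, gives that the product of the distances \<open>|z n - z m|\<close> over \<open>m \<noteq> n\<close> is at least \<open>r\<close>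
  divided by the norm of \<open>f\<close> (\<open>prod_dist_ge\<close>). This is regularity.

  The kernel is nonzero: near the boundary, \<open>f\<close> is smaller by a fixed factor on the disks
  \<open>D(z n, s n)\<close> than its norm. Removing the zeros of \<open>f\<close> in a large disk of radius \<open>\<sigma>\<close> hardly changes
  the norm and the values beyond, but leaves a function whose value at \<open>0\<close> nearly attains its norm;
  multiplied by an initial piece of its reciprocal series it becomes a function with norm close to \<open>1\<close>
  that agrees with \<open>1\<close> up to high order and is still bounded by a constant less than \<open>1\<close> on the disks
  with centre beyond \<open>\<sigma>\<close>. Powers of such functions are as small on these disks as desired
  (\<open>eventually_ex_damping_factor\<close>). An infinite product of them, with \<open>\<sigma>\<close> tending to \<open>1\<close>, is a nonzero
  element of the algebra that tends to \<open>0\<close> along the disks (\<open>ex_vanishing_at_boundary\<close>).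

  Suprema of bounded power series are computed from their truncations, which are uniformly close on every
  smaller disk. The truncations are polynomials, hence split into linear factors, and the supremum
  of a product of linear factors on a closed disk is given by an explicit formula
  (\<open>sup_on_linear_prod\<close>). Wherever zeros of \<open>f\<close> are mentioned above, those of a truncation serve.
\<close>


section \<open>Products over multisets\<close>

lemma prod_mset_nonneg:
  fixes g :: "'b \<Rightarrow> real"
  assumes "\<And>x. x \<in># A \<Longrightarrow> 0 \<le> g x"
  shows "0 \<le> (\<Prod>x\<in>#A. g x)"
  using assms by (induction A) auto

lemma prod_mset_mono:
  fixes g h :: "'b \<Rightarrow> real"
  assumes "\<And>x. x \<in># A \<Longrightarrow> 0 \<le> g x \<and> g x \<le> h x"
  shows "(\<Prod>x\<in>#A. g x) \<le> (\<Prod>x\<in>#A. h x)"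
  using assms
proof (induction A)
  case (add x A)
  have "0 \<le> (\<Prod>x\<in>#A. g x)" using add.prems by (intro prod_mset_nonneg) auto
  moreover have "0 \<le> g x" "g x \<le> h x" using add.prems[of x] by auto
  moreover have "(\<Prod>x\<in>#A. g x) \<le> (\<Prod>x\<in>#A. h x)" using add by auto
  ultimately show ?case by (simp add: mult_mono)
qed simp

lemma prod_mset_ge_power:
  fixes g :: "'b \<Rightarrow> real"
  assumes "\<And>x. x \<in># A \<Longrightarrow> a \<le> g x" "0 \<le> a"
  shows "a ^ size A \<le> (\<Prod>x\<in>#A. g x)"
  using prod_mset_mono[of A "\<lambda>_. a" g] assms by simp

lemma prod_mset_divide:
  fixes g h :: "'b \<Rightarrow> real"
  shows "(\<Prod>x\<in>#A. g x / h x) = (\<Prod>x\<in>#A. g x) / (\<Prod>x\<in>#A. h x)"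
  by (induction A) auto

lemma prod_mset_filter:
  fixes g :: "'b \<Rightarrow> real"
  shows "(\<Prod>x\<in>#A. g x) = (\<Prod>x\<in>#filter_mset P A. g x) * (\<Prod>x\<in>#filter_mset (\<lambda>x. \<not> P x) A. g x)"
  by (induction A) auto

lemma isCont_prod_mset_max:
  fixes k :: "'b \<Rightarrow> real"
  shows "isCont (\<lambda>t. \<Prod>\<rho>\<in>#A. max t (k \<rho>)) t"
proof (induction A)
  case (add x A)
  have "isCont (\<lambda>t. max t (k x) * (\<Prod>\<rho>\<in>#A. max t (k \<rho>))) t"
    by (intro isCont_mult continuous_max continuous_ident continuous_const add)
  thus ?case by simp
qed simp

lemma continuous_on_prod_mset_max:
  fixes k :: "'b \<Rightarrow> real"
  shows "continuous_on S (\<lambda>t. \<Prod>\<rho>\<in>#A. max t (k \<rho>))"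
  using isCont_prod_mset_max by (intro continuous_at_imp_continuous_on ballI)

section \<open>Ultrafilters\<close>

text \<open>
  By compactness of the interval the image filter has a cluster point, and an ultrafilter converges to
  each of its cluster points.
\<close>

lemma ultrafilter_tendsto:
  fixes g :: "'a \<Rightarrow> real"
  assumes u: "ultrafilter u" and g: "\<And>n. g n \<in> {a..b}"
  shows "\<exists>l. (g \<longlongrightarrow> l) u"
proof -
  have "filtermap g u \<noteq> bot" using u by (simp add: ultrafilter_def filtermap_bot_iff)
  moreover have "eventually (\<lambda>x. x \<in> {a..b}) (filtermap g u)"
    using g by (simp add: eventually_filtermap)
  ultimately obtain l where l: "inf (nhds l) (filtermap g u) \<noteq> bot"
    using compact_Icc[of a b] unfolding compact_filter by blast
  have "(g \<longlongrightarrow> l) u"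
  proof (rule topological_tendstoI)
    fix S assume S: "open S" "l \<in> S"
    show "\<forall>\<^sub>F n in u. g n \<in> S"
    proof (rule ccontr)
      assume "\<not> ?thesis"
      hence "\<forall>\<^sub>F n in u. g n \<notin> S" using u by (auto simp: ultrafilter_def)
      hence "\<forall>\<^sub>F x in filtermap g u. x \<notin> S" by (simp add: eventually_filtermap)
      moreover have "\<forall>\<^sub>F x in nhds l. x \<in> S" using S by (rule eventually_nhds_in_open)
      ultimately have "\<forall>\<^sub>F x in inf (nhds l) (filtermap g u). False"
        unfolding eventually_inf by (intro exI[of _ "\<lambda>x. x \<in> S"] exI[of _ "\<lambda>x. x \<notin> S"]) auto
      thus False using l by (simp add: eventually_False)
    qed
  qed
  thus ?thesis by blast
qed

lemma ultrafilter_filtermap: "ultrafilter u \<Longrightarrow> ultrafilter (filtermap p u)"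
  by (simp add: ultrafilter_def filtermap_bot_iff eventually_filtermap)

lemma nonprincipal_ultrafilter_finite:
  assumes u: "nonprincipal_ultrafilter u" and S: "finite S"
  shows "\<forall>\<^sub>F n in u. n \<notin> S"
proof -
  have ne: "u \<noteq> bot" using u by (simp add: nonprincipal_ultrafilter_def ultrafilter_def)
  have "\<forall>\<^sub>F n in u. n \<noteq> x" for x
  proof (rule ccontr)
    assume "\<not> ?thesis"
    hence x: "\<forall>\<^sub>F n in u. n = x"
      using u unfolding nonprincipal_ultrafilter_def ultrafilter_def by force
    have "u = principal {x}"
    proof (rule filter_eqI)
      fix P
      show "eventually P u \<longleftrightarrow> eventually P (principal {x})"
      proof
        assume "eventually P u"
        hence "\<exists>n. P n \<and> n = x" using x by (intro eventually_happens'[OF ne] eventually_conj)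
        thus "eventually P (principal {x})" by (simp add: eventually_principal)
      next
        assume "eventually P (principal {x})"
        hence "P x" by (simp add: eventually_principal)
        thus "eventually P u" using x by (auto elim: eventually_mono)
      qed
    qed
    thus False using u by (simp add: nonprincipal_ultrafilter_def)
  qed
  hence "\<forall>\<^sub>F n in u. \<forall>x\<in>S. n \<noteq> x" using S by (intro eventually_ball_finite) auto
  thus ?thesis by eventually_elim auto
qed

lemma nonprincipal_ultrafilter_le_sequentially:
  assumes "nonprincipal_ultrafilter u"
  shows "u \<le> sequentially"
proof (rule filter_leI)
  fix P :: "nat \<Rightarrow> bool" assume "eventually P sequentially"
  then obtain N where N: "\<And>n. n \<ge> N \<Longrightarrow> P n" by (auto simp: eventually_sequentially)
  have "\<forall>\<^sub>F n in u. n \<notin> {..<N}" using assms by (rule nonprincipal_ultrafilter_finite) simp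
  thus "eventually P u" by eventually_elim (use N in auto)
qed

text \<open>
  Passing to one index per set, namely the least one, makes the family disjoint, and the image ultrafilter
  yields the same limits. The set of representatives itself need not belong to \<open>u\<close>, since the number of
  indices that share a set may be unbounded; this is why the ultrafilter is pushed forward. It stays
  nonprincipal because the reindexing map is finite-to-one on \<open>A\<close>.
\<close>

lemma disjoint_reindexing:
  fixes D :: "nat \<Rightarrow> 'b set"
  assumes u: "nonprincipal_ultrafilter u" and A: "\<forall>\<^sub>F n in u. n \<in> A"
    and equal_or_disjoint: "\<And>m n. m \<in> A \<Longrightarrow> n \<in> A \<Longrightarrow> D m \<inter> D n \<noteq> {} \<Longrightarrow> D m = D n"
    and fin: "\<And>m. m \<in> A \<Longrightarrow> finite {n \<in> A. D n = D m}"
  shows "\<exists>p C. nonprincipal_ultrafilter (filtermap p u) \<and> C \<subseteq> A \<and> (\<forall>\<^sub>F n in filtermap p u. n \<in> C) \<and>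
    (\<forall>n\<in>A. D (p n) = D n) \<and> disjoint_family_on D C"
proof -
  define p where "p n = (LEAST m. m \<in> A \<and> D m = D n)" for n
  have p: "p n \<in> A" "D (p n) = D n" if "n \<in> A" for n
    using LeastI[of "\<lambda>m. m \<in> A \<and> D m = D n" n] that unfolding p_def by auto
  have u': "ultrafilter u" "u \<noteq> bot"
    using u by (auto simp: nonprincipal_ultrafilter_def ultrafilter_def)
  have "filtermap p u \<noteq> principal {m}" for m
  proof
    assume "filtermap p u = principal {m}"
    hence "\<forall>\<^sub>F n in filtermap p u. n = m" by (simp add: eventually_principal)
    hence ev: "\<forall>\<^sub>F n in u. p n = m" by (simp add: eventually_filtermap)
    hence "\<exists>n. n \<in> A \<and> p n = m" using A by (intro eventually_happens'[OF u'(2)] eventually_conj)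
    hence "m \<in> A" using p by auto
    have "\<forall>\<^sub>F n in u. n \<notin> {n \<in> A. D n = D m}"
      using u fin[OF \<open>m \<in> A\<close>] by (rule nonprincipal_ultrafilter_finite)
    hence "\<forall>\<^sub>F n in u. False" using ev A by eventually_elim (use p in auto)
    thus False using u' by (simp add: eventually_False)
  qed
  hence "nonprincipal_ultrafilter (filtermap p u)"
    using u'(1) by (simp add: nonprincipal_ultrafilter_def ultrafilter_filtermap)
  moreover have "disjoint_family_on D (p ` A)"
    unfolding disjoint_family_on_def
  proof (intro ballI impI, rule ccontr)
    fix m n assume *: "m \<in> p ` A" "n \<in> p ` A" "m \<noteq> n" "D m \<inter> D n \<noteq> {}"
    then obtain m' n' where m': "m' \<in> A" "m = p m'" and n': "n' \<in> A" "n = p n'" by auto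
    have "D m = D n" using * m' n' p by (intro equal_or_disjoint) auto
    hence "D m' = D n'" using m' n' p by simp
    hence "m = n" using m' n' by (simp add: p_def)
    thus False using * by simp
  qed
  moreover have "\<forall>\<^sub>F n in filtermap p u. n \<in> p ` A"
    unfolding eventually_filtermap using A by eventually_elim auto
  ultimately show ?thesis using p by (intro exI[of _ p] exI[of _ "p ` A"]) auto
qed

context complete_nonarch_field
begin

section \<open>The absolute value\<close>

lemma av_pos_iff: "0 < av x \<longleftrightarrow> x \<noteq> 0"
  using av_nonneg[of x] av_eq_0_iff[of x] by linarith

lemma av_inverse: "av (inverse x) = inverse (av x)"
proof (cases "x = 0")
  case False
  hence "av x * av (inverse x) = 1" by (simp add: av_1 flip: av_mult)
  thus ?thesis by (simp add: inverse_unique)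
qed (simp add: av_0)

lemma av_divide: "av (x / y) = av x / av y"
  by (simp add: divide_inverse av_mult av_inverse)

lemma av_prod_mset: "av (\<Prod>x\<in>#A. g x) = (\<Prod>x\<in>#A. av (g x))"
  by (induction A) (auto simp: av_1 av_mult)

lemma av_add_eq_max:
  assumes "av x \<noteq> av y"
  shows "av (x + y) = max (av x) (av y)"
proof -
  have "av x \<le> max (av (x + y)) (av y)" using av_diff_le[of "x + y" y] by simp
  moreover have "av y \<le> max (av (x + y)) (av x)" using av_diff_le[of "x + y" x] by simp
  ultimately show ?thesis using av_ultrametric[of x y] assms by linarith
qed

text \<open>
  The value group is dense because the field is algebraically closed. Hence a closed disk has the expected
  supremum of a polynomial even if its radius is not the absolute value of a field element.
\<close>

lemma ex_av_strictly_between: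
  assumes "a < b" "0 < b"
  shows "\<exists>x. a < av x \<and> av x < b"
proof -
  define a' where "a' = max a (b / 2)"
  have a': "0 < a'" "a' < b" "a \<le> a'" using assms by (auto simp: a'_def)
  \<comment> \<open>Multiplying by \<open>z\<close> shrinks an absolute value by so little that the
    powers of \<open>z\<close>, scaled by \<open>y\<close>, cannot jump over the interval.\<close>
  obtain z where z: "a' / b < av z" "av z < 1" using ex_av_between[of "a' / b"] a' assms by auto
  have "0 < a' / b" using a' assms by simp
  hence z0: "0 < av z" using z(1) by linarith
  obtain k where k: "av z ^ k < inverse b"
    using real_arch_pow_inv[of "inverse b" "av z"] z(2) assms by auto
  define y where "y = inverse z ^ k"
  have "av y = inverse (av z ^ k)" by (simp add: y_def av_power av_inverse power_inverse)
  hence y: "b < av y"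
    using less_imp_inverse_less[OF k] z0 by simp
  obtain n' where "av z ^ n' < b / av y"
    using real_arch_pow_inv[of "b / av y" "av z"] z(2) assms y by auto
  hence ex: "av y * av z ^ n' < b" using y assms by (simp add: field_simps)
  define n where "n = (LEAST n. av y * av z ^ n < b)"
  have n: "av y * av z ^ n < b" unfolding n_def using ex by (rule LeastI)
  have "n \<noteq> 0" using n y by (auto intro: ccontr)
  then obtain m where m: "n = Suc m" by (cases n) auto
  have "b \<le> av y * av z ^ m"
    using not_less_Least[of m "\<lambda>n. av y * av z ^ n < b"] m unfolding n_def by simp
  hence "b * av z \<le> av y * av z ^ n"
    using mult_right_mono[of b _ "av z"] z0 by (simp add: m ac_simps)
  moreover have "a' < b * av z" using z(1) assms by (simp add: field_simps)
  ultimately show ?thesis using n a' by (intro exI[of _ "y * z ^ n"]) (auto simp: av_mult av_power)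
qed

section \<open>Closed disks and suprema over them\<close>

lemma centre_in_closed_disk: "0 \<le> s \<Longrightarrow> c \<in> closed_disk av c s"
  by (simp add: closed_disk_def av_0)

lemma closed_disk_nonempty: "0 < s \<Longrightarrow> closed_disk av c s \<noteq> {}"
  using centre_in_closed_disk[of s c] by auto

lemma closed_disk_mono: "s \<le> t \<Longrightarrow> closed_disk av c s \<subseteq> closed_disk av c t"
  by (auto simp: closed_disk_def)

lemma closed_disk_recentre:
  assumes "av (c - d) \<le> s"
  shows "closed_disk av c s = closed_disk av d s"
proof -
  have "av (x - d) \<le> s \<longleftrightarrow> av (x - c) \<le> s" for x
    using av_ultrametric[of "x - c" "c - d"] av_diff_le[of "x - d" "c - d"] assms by auto
  thus ?thesis by (auto simp: closed_disk_def)
qed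

lemma av_le_if_mem_closed_disk:
  "x \<in> closed_disk av c s \<Longrightarrow> av x \<le> max (av c) s"
  using av_ultrametric[of "x - c" c] by (auto simp: closed_disk_def)

lemma closed_disk_subset_unit_disk:
  "c \<in> unit_disk av \<Longrightarrow> s < 1 \<Longrightarrow> closed_disk av c s \<subseteq> unit_disk av"
  using av_le_if_mem_closed_disk unfolding unit_disk_def by fastforce

definition sup_on :: "'k set \<Rightarrow> ('k \<Rightarrow> 'k) \<Rightarrow> real" where
  "sup_on D g = (SUP x\<in>D. av (g x))"

definition bounded_fn_on :: "'k set \<Rightarrow> ('k \<Rightarrow> 'k) \<Rightarrow> bool" where
  "bounded_fn_on D g \<longleftrightarrow> bdd_above ((\<lambda>x. av (g x)) ` D)"

lemma bounded_fn_onI: "(\<And>x. x \<in> D \<Longrightarrow> av (g x) \<le> B) \<Longrightarrow> bounded_fn_on D g"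
  unfolding bounded_fn_on_def by (rule bdd_aboveI2)

lemma av_le_sup_on: "bounded_fn_on D g \<Longrightarrow> x \<in> D \<Longrightarrow> av (g x) \<le> sup_on D g"
  unfolding bounded_fn_on_def sup_on_def by (rule cSUP_upper)

lemma sup_on_le: "D \<noteq> {} \<Longrightarrow> (\<And>x. x \<in> D \<Longrightarrow> av (g x) \<le> B) \<Longrightarrow> sup_on D g \<le> B"
  unfolding sup_on_def by (rule cSUP_least)

lemma sup_on_nonneg: "D \<noteq> {} \<Longrightarrow> bounded_fn_on D g \<Longrightarrow> 0 \<le> sup_on D g"
  using av_le_sup_on[of D g] av_nonneg by (metis all_not_in_conv order_trans)

lemma sup_on_perturb_le:
  assumes "D \<noteq> {}" "bounded_fn_on D g" "\<And>x. x \<in> D \<Longrightarrow> av (g x - h x) \<le> \<eta>"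
  shows "sup_on D h \<le> max (sup_on D g) \<eta>"
proof (rule sup_on_le)
  fix x assume x: "x \<in> D"
  have "av (h x) \<le> max (av (g x)) (av (g x - h x))" using av_diff_le[of "g x" "g x - h x"] by simp
  thus "av (h x) \<le> max (sup_on D g) \<eta>" using assms(3)[OF x] av_le_sup_on[OF assms(2) x] by linarith
qed fact

text \<open>
  The ultrametric inequality makes suprema of close functions equal, not just close, as soon as they exceed
  the error. Exact values of the supremum of a power series can therefore be read off a truncation.
\<close>

lemma sup_on_eq_if_close:
  assumes "D \<noteq> {}" "bounded_fn_on D g" "bounded_fn_on D h"
    "\<And>x. x \<in> D \<Longrightarrow> av (g x - h x) \<le> \<eta>" "\<eta> < sup_on D g"
  shows "sup_on D h = sup_on D g"
proof -
  have "sup_on D h \<le> max (sup_on D g) \<eta>" using assms by (intro sup_on_perturb_le)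
  moreover have "sup_on D g \<le> max (sup_on D h) \<eta>"
    using assms by (intro sup_on_perturb_le) (auto simp: av_minus_commute[of "h _"])
  ultimately show ?thesis using assms(5) by auto
qed

lemma tendsto_sup_on:
  assumes "D \<noteq> {}" "bounded_fn_on D g" "\<And>K. bounded_fn_on D (G K)"
    and "\<And>\<eta>. 0 < \<eta> \<Longrightarrow> \<forall>\<^sub>F K in sequentially. \<forall>x\<in>D. av (g x - G K x) \<le> \<eta>"
  shows "(\<lambda>K. sup_on D (G K)) \<longlonglongrightarrow> sup_on D g"
proof (rule tendstoI)
  fix e :: real assume "e > 0"
  hence "\<forall>\<^sub>F K in sequentially. \<forall>x\<in>D. av (g x - G K x) \<le> e / 2" by (intro assms(4)) simp
  thus "\<forall>\<^sub>F K in sequentially. dist (sup_on D (G K)) (sup_on D g) < e"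
  proof eventually_elim
    case (elim K)
    have "sup_on D (G K) \<le> max (sup_on D g) (e / 2)"
      using assms elim by (intro sup_on_perturb_le) auto
    moreover have "sup_on D g \<le> max (sup_on D (G K)) (e / 2)"
      using assms elim by (intro sup_on_perturb_le) (auto simp: av_minus_commute[of "G _ _"])
    moreover have "0 \<le> sup_on D g" "0 \<le> sup_on D (G K)" using assms sup_on_nonneg by auto
    ultimately show ?case using \<open>e > 0\<close> by (auto simp: dist_real_def)
  qed
qed

section \<open>Products of linear factors\<close>

definition linear_prod :: "'k \<Rightarrow> 'k multiset \<Rightarrow> 'k \<Rightarrow> 'k" where
  "linear_prod l A x = l * (\<Prod>\<rho>\<in>#A. x - \<rho>)"

lemma av_linear_prod: "av (linear_prod l A x) = av l * (\<Prod>\<rho>\<in>#A. av (x - \<rho>))"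
  by (simp add: linear_prod_def av_mult av_prod_mset)

lemma av_linear_prod_le:
  assumes "x \<in> closed_disk av c s"
  shows "av (linear_prod l A x) \<le> av l * (\<Prod>\<rho>\<in>#A. max s (av (c - \<rho>)))"
proof -
  have "av (x - \<rho>) \<le> max s (av (c - \<rho>))" for \<rho>
    using av_ultrametric[of "x - c" "c - \<rho>"] assms by (simp add: closed_disk_def)
  thus ?thesis unfolding av_linear_prod
    by (intro mult_left_mono prod_mset_mono) (auto simp: av_nonneg)
qed

lemma bounded_linear_prod: "bounded_fn_on (closed_disk av c s) (linear_prod l A)"
  using av_linear_prod_le by (rule bounded_fn_onI)

text \<open>
  This is the formula for the Gauss norm on a disk. A point at distance slightly less than \<open>s\<close> from the
  centre, but larger than the distances below \<open>s\<close> of the roots, nearly attains the bound for all factors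
  simultaneously.
\<close>

lemma sup_on_linear_prod:
  assumes "0 < s"
  shows "sup_on (closed_disk av c s) (linear_prod l A) = av l * (\<Prod>\<rho>\<in>#A. max s (av (c - \<rho>)))"
proof (rule antisym)
  let ?D = "closed_disk av c s"
  show "sup_on ?D (linear_prod l A) \<le> av l * (\<Prod>\<rho>\<in>#A. max s (av (c - \<rho>)))"
    using av_linear_prod_le closed_disk_nonempty[OF assms] by (intro sup_on_le)
  define S where "S = insert 0 ((\<lambda>\<rho>. av (c - \<rho>)) ` {\<rho> \<in> set_mset A. av (c - \<rho>) < s})"
  have S: "finite S" "S \<noteq> {}" "\<forall>t\<in>S. t < s" unfolding S_def using assms by auto
  hence "Max S < s" by simp
  \<comment> \<open>No root has a distance from \<open>c\<close> in the interval from \<open>t\<close>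
    to \<open>s\<close>, so if \<open>av y\<close> lies there, the strict ultrametric equality
    determines the distance of \<open>c + y\<close> from every root.\<close>
  have "av l * (\<Prod>\<rho>\<in>#A. max t (av (c - \<rho>))) \<le> sup_on ?D (linear_prod l A)"
    if t: "Max S < t" "t < s" for t
  proof -
    have tS: "\<And>u. u \<in> S \<Longrightarrow> u < t" using Max_ge[OF S(1)] t by fastforce
    have "0 < t" by (rule tS) (simp add: S_def)
    obtain y where y: "t < av y" "av y < s" using ex_av_strictly_between[OF t(2)] \<open>0 < s\<close> by blast
    have "max t (av (c - \<rho>)) \<le> av (c + y - \<rho>)" if "\<rho> \<in># A" for \<rho>
    proof -
      have "av (c - \<rho>) < t \<or> s \<le> av (c - \<rho>)" using tS[of "av (c - \<rho>)"] that by (cases "av (c - \<rho>) < s") (auto simp: S_def)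
      hence "av (y + (c - \<rho>)) = max (av y) (av (c - \<rho>))" using y by (intro av_add_eq_max) auto
      moreover have "y + (c - \<rho>) = c + y - \<rho>" by simp
      ultimately show ?thesis using y by auto
    qed
    hence "av l * (\<Prod>\<rho>\<in>#A. max t (av (c - \<rho>))) \<le> av (linear_prod l A (c + y))"
      unfolding av_linear_prod using \<open>0 < t\<close>
      by (intro mult_left_mono prod_mset_mono) (simp_all add: av_nonneg less_imp_le le_max_iff_disj)
    also have "\<dots> \<le> sup_on ?D (linear_prod l A)"
      using y by (intro av_le_sup_on bounded_linear_prod) (simp add: closed_disk_def)
    finally show ?thesis .
  qed
  hence ev: "\<forall>\<^sub>F t in at_left s. av l * (\<Prod>\<rho>\<in>#A. max t (av (c - \<rho>))) \<le> sup_on ?D (linear_prod l A)"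
    using \<open>Max S < s\<close> unfolding eventually_at_left_field by blast
  have "isCont (\<lambda>t. av l * (\<Prod>\<rho>\<in>#A. max t (av (c - \<rho>)))) s"
    by (intro isCont_mult continuous_const isCont_prod_mset_max)
  hence "((\<lambda>t. av l * (\<Prod>\<rho>\<in>#A. max t (av (c - \<rho>)))) \<longlongrightarrow> av l * (\<Prod>\<rho>\<in>#A. max s (av (c - \<rho>)))) (at_left s)"
    by (simp add: isCont_def filterlim_at_split)
  thus "av l * (\<Prod>\<rho>\<in>#A. max s (av (c - \<rho>))) \<le> sup_on ?D (linear_prod l A)"
    using ev by (rule tendsto_upperbound) simp
qed

lemma linear_prod_mult: "linear_prod l A x * linear_prod m B x = linear_prod (l * m) (A + B) x"
  by (simp add: linear_prod_def)

lemma sup_on_linear_prod_mult: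
  assumes "0 < s"
  shows "sup_on (closed_disk av c s) (\<lambda>x. linear_prod l A x * linear_prod m B x) =
    sup_on (closed_disk av c s) (linear_prod l A) * sup_on (closed_disk av c s) (linear_prod m B)"
  using sup_on_linear_prod[OF assms, of c "l * m" "A + B"]
  by (simp add: linear_prod_mult sup_on_linear_prod[OF assms] av_mult)

section \<open>Values of bounded power series\<close>

definition trunc :: "nat \<Rightarrow> 'k fps \<Rightarrow> 'k \<Rightarrow> 'k" where
  "trunc K f x = (\<Sum>k<K. fps_nth f k * x ^ k)"

lemma trunc_eq_linear_prod: "\<exists>l A. trunc K f = linear_prod l A"
proof -
  define p where "p = (\<Sum>k<K. monom (fps_nth f k) k)"
  have p: "poly p x = trunc K f x" for x by (simp add: p_def trunc_def poly_sum poly_monom)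
  show ?thesis
  proof (cases "p = 0")
    case True
    thus ?thesis using p by (intro exI[of _ 0]) (auto simp: linear_prod_def)
  next
    case False
    then obtain A where A: "p = smult (lead_coeff p) (\<Prod>x\<in>#A. [:-x, 1:])"
      using alg_closed_imp_factorization by metis
    have "poly (\<Prod>x\<in>#A. [:-x, 1:]) x = (\<Prod>\<rho>\<in>#A. x - \<rho>)" for x by (induction A) (auto simp: algebra_simps)
    hence "poly p x = linear_prod (lead_coeff p) A x" for x
      by (subst A) (simp add: linear_prod_def)
    thus ?thesis using p by (metis ext)
  qed
qed

lemma bounded_trunc: "bounded_fn_on (closed_disk av c s) (trunc K f)"
  using trunc_eq_linear_prod[of K f] bounded_linear_prod by auto

lemma Hinf_norm_nonneg: "f \<in> Hinf av \<Longrightarrow> 0 \<le> Hinf_norm av f"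
  using av_coeff_le_norm[of f 0] av_nonneg[of "fps_nth f 0"] by linarith

lemma av_term_le:
  assumes "f \<in> Hinf av" "av x \<le> \<sigma>" "\<sigma> \<le> 1" "K \<le> k"
  shows "av (fps_nth f k * x ^ k) \<le> Hinf_norm av f * \<sigma> ^ K"
proof -
  have "0 \<le> \<sigma>" using assms(2) av_nonneg[of x] by linarith
  have "av x ^ k \<le> \<sigma> ^ k" using assms av_nonneg by (intro power_mono) auto
  also have "\<dots> \<le> \<sigma> ^ K" using assms \<open>0 \<le> \<sigma>\<close> by (intro power_decreasing) auto
  finally show ?thesis unfolding av_mult av_power
    using av_coeff_le_norm[OF assms(1)] Hinf_norm_nonneg[OF assms(1)] av_nonneg
    by (intro mult_mono) auto
qed

lemma av_trunc_le:
  assumes "f \<in> Hinf av" "av x \<le> 1"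
  shows "av (trunc K f x) \<le> Hinf_norm av f"
  unfolding trunc_def using av_term_le[OF assms, of 0] Hinf_norm_nonneg[OF assms(1)]
  by (intro av_sum_le) auto

lemma av_fps_value_diff_trunc_le:
  assumes "f \<in> Hinf av" "av x \<le> \<sigma>" "\<sigma> < 1"
  shows "av (fps_value av f x - trunc K f x) \<le> Hinf_norm av f * \<sigma> ^ K"
  unfolding trunc_def using assms av_term_le[OF assms(1,2)]
  by (intro fps_sums_to_tail_le Hinf_sums_to) (auto simp: unit_disk_def)

lemma trunc_eventually_close:
  assumes "f \<in> Hinf av" "0 \<le> \<sigma>" "\<sigma> < 1" "0 < \<eta>"
  shows "\<forall>\<^sub>F K in sequentially. \<forall>x. av x \<le> \<sigma> \<longrightarrow> av (fps_value av f x - trunc K f x) \<le> \<eta>"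
proof -
  have "(\<lambda>K. Hinf_norm av f * \<sigma> ^ K) \<longlonglongrightarrow> 0"
    using assms by (intro tendsto_mult_right_zero LIMSEQ_power_zero) auto
  hence "\<forall>\<^sub>F K in sequentially. Hinf_norm av f * \<sigma> ^ K < \<eta>"
    using assms(4) by (rule order_tendstoD)
  thus ?thesis
  proof eventually_elim
    case (elim K)
    thus ?case using av_fps_value_diff_trunc_le[OF assms(1) _ assms(3)] by (meson less_imp_le order_trans)
  qed
qed

lemma trunc_eventually_close_on_disk:
  assumes "f \<in> Hinf av" "c \<in> unit_disk av" "0 < s" "s < 1" "0 < \<eta>"
  shows "\<forall>\<^sub>F K in sequentially. \<forall>x\<in>closed_disk av c s. av (fps_value av f x - trunc K f x) \<le> \<eta>"
proof -
  have "max (av c) s < 1" using assms by (auto simp: unit_disk_def)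
  with trunc_eventually_close[OF assms(1) _ this assms(5)] assms(3)
  have "\<forall>\<^sub>F K in sequentially. \<forall>x. av x \<le> max (av c) s \<longrightarrow> av (fps_value av f x - trunc K f x) \<le> \<eta>"
    by simp
  thus ?thesis by eventually_elim (auto dest: av_le_if_mem_closed_disk)
qed

lemma fps_value_eqI_bound:
  assumes "\<And>n. av (trunc n f x - w) \<le> e n" "e \<longlonglongrightarrow> 0"
  shows "fps_value av f x = w"
proof (rule fps_value_eqI, unfold fps_sums_to_iff trunc_def[symmetric], intro allI impI)
  fix \<epsilon> :: real assume "\<epsilon> > 0"
  hence "\<forall>\<^sub>F n in sequentially. e n < \<epsilon>" using assms(2) by (intro order_tendstoD)
  then obtain N where "\<And>n. n \<ge> N \<Longrightarrow> e n < \<epsilon>" by (auto simp: eventually_sequentially)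
  thus "\<exists>N. \<forall>n\<ge>N. av (trunc n f x - w) < \<epsilon>" using assms(1) by (meson le_less_trans)
qed

text \<open>
  Cauchy product: the truncation of the product and the product of the truncations differ by terms of high
  degree only, and their coefficients are bounded.
\<close>

lemma fps_value_mult:
  assumes f: "f \<in> Hinf av" and g: "g \<in> Hinf av" and x: "x \<in> unit_disk av"
  shows "fps_value av (f * g) x = fps_value av f x * fps_value av g x"
proof (rule fps_value_eqI_bound)
  define B where "B = Hinf_norm av f * Hinf_norm av g"
  have x1: "av x < 1" using x by (simp add: unit_disk_def)
  have nonneg: "0 \<le> Hinf_norm av f" "0 \<le> Hinf_norm av g" using f g Hinf_norm_nonneg by auto
  show "(\<lambda>n. B * av x ^ n) \<longlonglongrightarrow> 0"
    using x1 av_nonneg by (intro tendsto_mult_right_zero LIMSEQ_power_zero) auto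
  fix n
  define t where "t = (\<lambda>i j. fps_nth f i * x ^ i * (fps_nth g j * x ^ j))"
  have "trunc n (f * g) x = (\<Sum>k<n. \<Sum>i\<le>k. t i (k - i))"
    unfolding trunc_def fps_mult_nth sum_distrib_right t_def
    by (intro sum.cong) (auto simp: atLeast0AtMost mult_ac simp flip: power_add)
  also have "\<dots> = (\<Sum>(i, j)\<in>{(i, j). i + j < n}. t i j)"
    by (rule sum.triangle_reindex[symmetric])
  finally have fg: "trunc n (f * g) x = (\<Sum>(i, j)\<in>{(i, j). i + j < n}. t i j)" .
  have "trunc n f x * trunc n g x = (\<Sum>(i, j)\<in>{..<n} \<times> {..<n}. t i j)"
    unfolding trunc_def t_def sum_product sum.cartesian_product ..
  \<comment> \<open>The terms of the product of the truncations that are absent from the truncation of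
    the product have degree at least \<open>n\<close>.\<close>
  hence "trunc n f x * trunc n g x - trunc n (f * g) x =
      (\<Sum>(i, j)\<in>{..<n} \<times> {..<n} - {(i, j). i + j < n}. t i j)"
    unfolding fg by (subst sum_diff) auto
  also have "av \<dots> \<le> B * av x ^ n"
  proof (intro av_sum_le)
    fix p assume "p \<in> {..<n} \<times> {..<n} - {(i, j). i + j < n}"
    then obtain i j where p: "p = (i, j)" "n \<le> i + j" by fastforce
    have "av (t i j) = av (fps_nth f i) * av (fps_nth g j) * av x ^ (i + j)"
      by (simp add: t_def av_mult av_power power_add)
    also have "\<dots> \<le> B * av x ^ n"
      unfolding B_def using p x1 nonneg av_nonneg av_coeff_le_norm[OF f] av_coeff_le_norm[OF g]
      by (intro mult_mono power_decreasing) auto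
    finally show "av (case p of (i, j) \<Rightarrow> t i j) \<le> B * av x ^ n" by (simp add: p)
  qed (use nonneg av_nonneg in \<open>auto simp: B_def\<close>)
  finally have 1: "av (trunc n f x * trunc n g x - trunc n (f * g) x) \<le> B * av x ^ n" .
  have *: "av (fps_value av f x - trunc n f x) \<le> Hinf_norm av f * av x ^ n"
    "av (fps_value av g x - trunc n g x) \<le> Hinf_norm av g * av x ^ n"
    using av_fps_value_diff_trunc_le f g x1 by auto
  have "av (fps_value av f x * (fps_value av g x - trunc n g x)) \<le>
      Hinf_norm av f * (Hinf_norm av g * av x ^ n)"
    unfolding av_mult using * Hinf_sums_to(2)[OF f x] nonneg av_nonneg by (intro mult_mono) auto
  moreover have "av (trunc n g x * (fps_value av f x - trunc n f x)) \<le>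
      Hinf_norm av g * (Hinf_norm av f * av x ^ n)"
    unfolding av_mult using * av_trunc_le[OF g] x1 nonneg av_nonneg by (intro mult_mono) auto
  ultimately have "av (fps_value av f x * (fps_value av g x - trunc n g x) +
      trunc n g x * (fps_value av f x - trunc n f x)) \<le> B * av x ^ n"
    using av_ultrametric[of "fps_value av f x * (fps_value av g x - trunc n g x)"
      "trunc n g x * (fps_value av f x - trunc n f x)"] by (simp add: B_def ac_simps)
  moreover have "fps_value av f x * (fps_value av g x - trunc n g x) +
      trunc n g x * (fps_value av f x - trunc n f x) =
      fps_value av f x * fps_value av g x - trunc n f x * trunc n g x"
    by (simp add: algebra_simps)
  ultimately have 2: "av (fps_value av f x * fps_value av g x - trunc n f x * trunc n g x) \<le> B * av x ^ n"
    by simp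
  have "fps_value av f x * fps_value av g x - trunc n (f * g) x =
    (fps_value av f x * fps_value av g x - trunc n f x * trunc n g x) +
    (trunc n f x * trunc n g x - trunc n (f * g) x)" by simp
  also have "av \<dots> \<le> B * av x ^ n"
    using order_trans[OF av_ultrametric max.boundedI[OF 2 1]] .
  finally show "av (trunc n (f * g) x - fps_value av f x * fps_value av g x) \<le> B * av x ^ n"
    by (simp add: av_minus_commute)
qed

lemma fps_value_add:
  assumes f: "f \<in> Hinf av" and g: "g \<in> Hinf av" and x: "x \<in> unit_disk av"
  shows "fps_value av (f + g) x = fps_value av f x + fps_value av g x"
proof (rule fps_value_eqI_bound)
  have x1: "av x < 1" using x by (simp add: unit_disk_def)
  show "(\<lambda>n. max (Hinf_norm av f * av x ^ n) (Hinf_norm av g * av x ^ n)) \<longlonglongrightarrow> 0"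
    using tendsto_max[OF tendsto_mult_right_zero tendsto_mult_right_zero, OF LIMSEQ_power_zero LIMSEQ_power_zero, of "av x" "av x"]
      x1 av_nonneg[of x] by simp
  fix n
  have *: "av (trunc n f x - fps_value av f x) \<le> Hinf_norm av f * av x ^ n"
    "av (trunc n g x - fps_value av g x) \<le> Hinf_norm av g * av x ^ n"
    using av_fps_value_diff_trunc_le f g x1 by (auto simp: av_minus_commute[of "trunc _ _ _"])
  have "trunc n (f + g) x - (fps_value av f x + fps_value av g x) =
     (trunc n f x - fps_value av f x) + (trunc n g x - fps_value av g x)"
    by (simp add: trunc_def sum.distrib algebra_simps)
  also have "av \<dots> \<le> max (av (trunc n f x - fps_value av f x)) (av (trunc n g x - fps_value av g x))"
    by (rule av_ultrametric)
  also have "\<dots> \<le> max (Hinf_norm av f * av x ^ n) (Hinf_norm av g * av x ^ n)"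
    using * by (rule max.mono)
  finally show "av (trunc n (f + g) x - (fps_value av f x + fps_value av g x)) \<le>
     max (Hinf_norm av f * av x ^ n) (Hinf_norm av g * av x ^ n)" .
qed

lemma fps_value_0: "fps_value av 0 x = 0"
  by (rule fps_value_eqI_bound[where e = "\<lambda>_. 0"]) (auto simp: trunc_def av_0)

lemma fps_value_1: "fps_value av 1 x = 1"
proof (rule fps_value_eqI_bound[where e = "\<lambda>n. if n = 0 then 1 else 0"])
  show "av (trunc n 1 x - 1) \<le> (if n = 0 then 1 else 0)" for n
    by (cases n) (auto simp: trunc_def av_0 av_1 av_minus sum.lessThan_Suc_shift simp del: sum.lessThan_Suc)
  show "(\<lambda>n::nat. if n = 0 then 1 else (0::real)) \<longlonglongrightarrow> 0"
    by (rule tendsto_eventually) (auto intro: eventually_sequentiallyI[of 1])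
qed

section \<open>Disk seminorms\<close>

text \<open>
  The seminorm of a closed disk as a function on all power series, without the restriction to
  the algebra that \<open>disk_seminorm\<close> contains.
\<close>

definition zeta :: "'k \<Rightarrow> real \<Rightarrow> 'k fps \<Rightarrow> real" where
  "zeta c s f = sup_on (closed_disk av c s) (fps_value av f)"

lemma disk_seminorm_eq_zeta:
  "disk_seminorm av (closed_disk av c s) = (\<lambda>f\<in>Hinf av. zeta c s f)"
  by (simp add: disk_seminorm_def zeta_def sup_on_def)

lemma bounded_fps_value:
  "f \<in> Hinf av \<Longrightarrow> c \<in> unit_disk av \<Longrightarrow> s < 1 \<Longrightarrow> bounded_fn_on (closed_disk av c s) (fps_value av f)"
  using Hinf_sums_to(2) closed_disk_subset_unit_disk by (intro bounded_fn_onI) blast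

lemma av_fps_value_le_zeta:
  "f \<in> Hinf av \<Longrightarrow> c \<in> unit_disk av \<Longrightarrow> s < 1 \<Longrightarrow> x \<in> closed_disk av c s \<Longrightarrow> av (fps_value av f x) \<le> zeta c s f"
  unfolding zeta_def by (intro av_le_sup_on bounded_fps_value)

lemma zeta_le:
  "0 < s \<Longrightarrow> (\<And>x. x \<in> closed_disk av c s \<Longrightarrow> av (fps_value av f x) \<le> B) \<Longrightarrow> zeta c s f \<le> B"
  unfolding zeta_def by (intro sup_on_le closed_disk_nonempty)

lemma zeta_le_norm:
  assumes "f \<in> Hinf av" "c \<in> unit_disk av" "0 < s" "s < 1"
  shows "zeta c s f \<le> Hinf_norm av f"
  using assms closed_disk_subset_unit_disk[OF assms(2,4)] by (intro zeta_le Hinf_sums_to(2)) auto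

lemma zeta_nonneg:
  "f \<in> Hinf av \<Longrightarrow> c \<in> unit_disk av \<Longrightarrow> 0 < s \<Longrightarrow> s < 1 \<Longrightarrow> 0 \<le> zeta c s f"
  unfolding zeta_def by (intro sup_on_nonneg closed_disk_nonempty bounded_fps_value)

lemma zeta_mono:
  assumes "f \<in> Hinf av" "d \<in> unit_disk av" "t < 1" "0 < s" "closed_disk av c s \<subseteq> closed_disk av d t"
  shows "zeta c s f \<le> zeta d t f"
  using assms by (intro zeta_le av_fps_value_le_zeta) auto

lemma zeta_add_le:
  assumes "f \<in> Hinf av" "g \<in> Hinf av" "c \<in> unit_disk av" "0 < s" "s < 1"
  shows "zeta c s (f + g) \<le> max (zeta c s f) (zeta c s g)"
proof (rule zeta_le)
  fix x assume x: "x \<in> closed_disk av c s"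
  hence "x \<in> unit_disk av" using closed_disk_subset_unit_disk assms by blast
  hence "fps_value av (f + g) x = fps_value av f x + fps_value av g x"
    using assms by (intro fps_value_add)
  moreover have "av (fps_value av f x) \<le> zeta c s f" "av (fps_value av g x) \<le> zeta c s g"
    using assms x by (auto intro: av_fps_value_le_zeta)
  ultimately show "av (fps_value av (f + g) x) \<le> max (zeta c s f) (zeta c s g)"
    using av_ultrametric[of "fps_value av f x" "fps_value av g x"] by auto
qed fact

text \<open>
  Multiplicativity is inherited from products of linear factors by letting the degree of truncation grow.
\<close>

lemma zeta_mult:
  assumes f: "f \<in> Hinf av" and g: "g \<in> Hinf av" and c: "c \<in> unit_disk av" and s: "0 < s" "s < 1"
  shows "zeta c s (f * g) = zeta c s f * zeta c s g"
proof (rule LIMSEQ_unique)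
  let ?D = "closed_disk av c s"
  have D: "?D \<noteq> {}" "?D \<subseteq> unit_disk av" using c s closed_disk_nonempty closed_disk_subset_unit_disk by auto
  have bdd: "bounded_fn_on ?D (\<lambda>x. trunc K f x * trunc K g x)" for K
    using trunc_eq_linear_prod[of K f] trunc_eq_linear_prod[of K g] bounded_linear_prod
    by (auto simp: linear_prod_mult)
  have sup: "sup_on ?D (\<lambda>x. trunc K f x * trunc K g x) = sup_on ?D (trunc K f) * sup_on ?D (trunc K g)" for K
    using trunc_eq_linear_prod[of K f] trunc_eq_linear_prod[of K g] sup_on_linear_prod_mult[OF s(1)] by auto
  have *: "(\<lambda>K. sup_on ?D (trunc K h)) \<longlonglongrightarrow> zeta c s h" if "h \<in> Hinf av" for h
    unfolding zeta_def using that c s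
    by (intro tendsto_sup_on D bounded_fps_value bounded_trunc trunc_eventually_close_on_disk)
  show "(\<lambda>K. sup_on ?D (\<lambda>x. trunc K f x * trunc K g x)) \<longlonglongrightarrow> zeta c s f * zeta c s g"
    unfolding sup using f g by (intro tendsto_mult *)
  show "(\<lambda>K. sup_on ?D (\<lambda>x. trunc K f x * trunc K g x)) \<longlonglongrightarrow> zeta c s (f * g)"
    unfolding zeta_def
  proof (intro tendsto_sup_on D bounded_fps_value bdd Hinf_mult f g c s)
    fix \<eta> :: real assume "\<eta> > 0"
    define M where "M = 1 + Hinf_norm av f + Hinf_norm av g"
    have n: "0 \<le> Hinf_norm av f" "0 \<le> Hinf_norm av g" using f g Hinf_norm_nonneg by auto
    have M: "0 < M" "Hinf_norm av f \<le> M" "Hinf_norm av g \<le> M" using n by (auto simp: M_def)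
    have "0 < \<eta> / M" using \<open>\<eta> > 0\<close> M by simp
    from trunc_eventually_close_on_disk[OF f c s this] trunc_eventually_close_on_disk[OF g c s this]
    show "\<forall>\<^sub>F K in sequentially. \<forall>x\<in>?D. av (fps_value av (f * g) x - trunc K f x * trunc K g x) \<le> \<eta>"
    proof eventually_elim
      case (elim K)
      show ?case
      proof
        fix x assume x: "x \<in> ?D"
        hence xu: "x \<in> unit_disk av" using D by blast
        have "av (fps_value av f x * (fps_value av g x - trunc K g x)) \<le> M * (\<eta> / M)"
          unfolding av_mult using elim(2) x Hinf_sums_to(2)[OF f xu] M av_nonneg
          by (intro mult_mono) auto
        moreover have "av (trunc K g x * (fps_value av f x - trunc K f x)) \<le> M * (\<eta> / M)"
          unfolding av_mult using elim(1) x av_trunc_le[OF g, of x K] xu M av_nonneg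
          by (intro mult_mono) (auto simp: unit_disk_def)
        ultimately have "av (fps_value av f x * (fps_value av g x - trunc K g x) +
            trunc K g x * (fps_value av f x - trunc K f x)) \<le> \<eta>"
          using av_ultrametric[of "fps_value av f x * (fps_value av g x - trunc K g x)"
            "trunc K g x * (fps_value av f x - trunc K f x)"] M by auto
        thus "av (fps_value av (f * g) x - trunc K f x * trunc K g x) \<le> \<eta>"
          unfolding fps_value_mult[OF f g xu] by (simp add: algebra_simps)
      qed
    qed
  qed
qed

lemma disk_seminorm_in_Berk:
  assumes "c \<in> unit_disk av" "0 < s" "s < 1"
  shows "disk_seminorm av (closed_disk av c s) \<in> Berk av"
proof -
  have "zeta c s 0 = 0" "zeta c s 1 = 1"
    using closed_disk_nonempty[OF assms(2), of c]
    by (simp_all add: zeta_def sup_on_def fps_value_0 fps_value_1 av_0 av_1)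
  moreover have "zeta c s (f + g) \<le> zeta c s f + zeta c s g" if "f \<in> Hinf av" "g \<in> Hinf av" for f g
    using zeta_add_le[OF that assms] zeta_nonneg[OF that(1) assms] zeta_nonneg[OF that(2) assms] by simp
  ultimately show ?thesis
    unfolding disk_seminorm_eq_zeta Berk_def using assms
    by (auto simp: Hinf_0 Hinf_1 Hinf_add Hinf_mult zeta_mult zeta_nonneg zeta_le_norm)
qed

text \<open>
  Cauchy's inequality on a disk about \<open>0\<close>. It is known for circles that contain a point of the field; the
  radius \<open>\<sigma>\<close> is approached by such circles from below.
\<close>

lemma coeff_le_zeta:
  assumes f: "f \<in> Hinf av" and \<sigma>: "0 < \<sigma>" "\<sigma> < 1"
  shows "av (fps_nth f k) * \<sigma> ^ k \<le> zeta 0 \<sigma> f"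
proof -
  have 0: "0 \<in> unit_disk av" by (simp add: unit_disk_def av_0)
  have le: "av (fps_nth f k) * t ^ k \<le> zeta 0 \<sigma> f" if t: "0 < t" "t < \<sigma>" for t
  proof -
    obtain y where y: "t < av y" "av y < \<sigma>" using ex_av_strictly_between[OF t(2) \<sigma>(1)] by blast
    have "av (fps_nth f k) * t ^ k \<le> av (fps_nth f k * y ^ k)"
      unfolding av_mult av_power using y t by (intro mult_left_mono power_mono) (auto simp: av_nonneg)
    also have "\<dots> \<le> zeta 0 \<sigma> f"
    proof (rule av_coeff_le_if_values_le)
      fix \<omega> :: 'k assume "av \<omega> = 1"
      hence "\<omega> * y \<in> closed_disk av 0 \<sigma>" using y by (simp add: closed_disk_def av_mult)
      moreover from this have "\<omega> * y \<in> unit_disk av"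
        using closed_disk_subset_unit_disk[OF 0 \<sigma>(2)] by blast
      ultimately show "\<exists>w. fps_sums_to av f (\<omega> * y) w \<and> av w \<le> zeta 0 \<sigma> f"
        using Hinf_sums_to(1)[OF f] av_fps_value_le_zeta[OF f 0 \<sigma>(2)] by blast
    qed
    finally show ?thesis .
  qed
  have "isCont (\<lambda>t. av (fps_nth f k) * t ^ k) \<sigma>" by simp
  hence "((\<lambda>t. av (fps_nth f k) * t ^ k) \<longlongrightarrow> av (fps_nth f k) * \<sigma> ^ k) (at_left \<sigma>)"
    by (simp add: isCont_def filterlim_at_split)
  moreover have "\<forall>\<^sub>F t in at_left \<sigma>. av (fps_nth f k) * t ^ k \<le> zeta 0 \<sigma> f"
    unfolding eventually_at_left_field using le \<sigma>(1) by blast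
  ultimately show ?thesis by (rule tendsto_upperbound) simp
qed

lemma eventually_zeta_gt:
  assumes f: "f \<in> Hinf av" and r: "r < Hinf_norm av f"
  shows "\<forall>\<^sub>F \<sigma> in at_left 1. r < zeta 0 \<sigma> f"
proof -
  obtain k where k: "r < av (fps_nth f k)"
    using r f unfolding Hinf_norm_def Hinf_def by (subst (asm) less_cSUP_iff) auto
  have "isCont (\<lambda>t. av (fps_nth f k) * t ^ k) 1" by simp
  hence "((\<lambda>t. av (fps_nth f k) * t ^ k) \<longlongrightarrow> av (fps_nth f k)) (at_left 1)"
    by (simp add: isCont_def filterlim_at_split)
  hence 1: "\<forall>\<^sub>F t in at_left 1. r < av (fps_nth f k) * t ^ k" using k by (rule order_tendstoD)
  have 2: "\<forall>\<^sub>F t in at_left 1. t \<in> {0<..<(1::real)}" by (rule eventually_at_leftI[of 0]) auto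
  from 1 2 show ?thesis
    by eventually_elim (use coeff_le_zeta[OF f] in \<open>force intro: less_le_trans\<close>)
qed

lemma zeta_eq_sup_on_trunc:
  assumes "f \<in> Hinf av" "c \<in> unit_disk av" "0 < s" "s < 1" "0 \<le> \<eta>"
    and "\<And>x. x \<in> closed_disk av c s \<Longrightarrow> av (fps_value av f x - trunc K f x) \<le> \<eta>"
    and "\<eta> < zeta c s f \<or> \<eta> < sup_on (closed_disk av c s) (trunc K f)"
  shows "sup_on (closed_disk av c s) (trunc K f) = zeta c s f"
proof -
  have D: "closed_disk av c s \<noteq> {}" using assms closed_disk_nonempty by auto
  show ?thesis using assms(7)
  proof
    assume "\<eta> < zeta c s f"
    thus ?thesis unfolding zeta_def using assms
      by (intro sup_on_eq_if_close[OF D bounded_fps_value bounded_trunc]) auto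
  next
    assume *: "\<eta> < sup_on (closed_disk av c s) (trunc K f)"
    show ?thesis unfolding zeta_def using assms *
      by (intro sup_on_eq_if_close[OF D bounded_trunc bounded_fps_value, symmetric])
        (auto simp: av_minus_commute[of "trunc _ _ _"])
  qed
qed

section \<open>Disks of maximal radius\<close>

definition maximal_radius :: "'k fps \<Rightarrow> real \<Rightarrow> 'k \<Rightarrow> real \<Rightarrow> bool" where
  "maximal_radius f r c s \<longleftrightarrow> 0 < s \<and> s < 1 \<and> zeta c s f = r \<and> (\<forall>s'. s < s' \<and> s' < 1 \<longrightarrow> r < zeta c s' f)"

text \<open>
  The supremum on the disk of radius \<open>s\<close> agrees with that of a truncation wherever it matters, and the
  latter is continuous in \<open>s\<close> by the product formula. The intermediate value theorem applies.
\<close>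

lemma ex_maximal_radius:
  assumes f: "f \<in> Hinf av" and c: "c \<in> unit_disk av" and t: "0 < t" "t < 1" "zeta c t f < r"
    and r: "0 < r" "r < Hinf_norm av f"
  shows "\<exists>s\<ge>t. maximal_radius f r c s"
proof -
  define t' where "t' = max (av c) t"
  have "t' < 1" using c t by (auto simp: t'_def unit_disk_def)
  hence "\<forall>\<^sub>F \<sigma> in at_left 1. \<sigma> \<in> {t'<..<1}" by (intro eventually_at_leftI[of t']) auto
  hence "\<forall>\<^sub>F \<sigma> in at_left 1. \<sigma> \<in> {t'<..<1} \<and> r < zeta 0 \<sigma> f"
    using eventually_zeta_gt[OF f r(2)] by (rule eventually_conj)
  then obtain \<sigma> where "t' < \<sigma>" "\<sigma> < 1" and *: "r < zeta 0 \<sigma> f"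
    using eventually_happens'[of "at_left (1::real)"] by auto
  hence \<sigma>: "av c < \<sigma>" "t < \<sigma>" "\<sigma> < 1" by (auto simp: t'_def)
  have \<sigma>r: "r < zeta c \<sigma> f"
    using * closed_disk_recentre[of c 0 \<sigma>] \<sigma> by (simp add: zeta_def)
  \<comment> \<open>A truncation with an error of at most \<open>\<eta> < r\<close> has the same
    supremum as \<open>f\<close> on every disk where one of the two suprema exceeds
    \<open>\<eta>\<close>.\<close>
  define \<eta> where "\<eta> = r / 2"
  have \<eta>: "0 < \<eta>" "\<eta> < r" using r by (auto simp: \<eta>_def)
  have "\<forall>\<^sub>F K in sequentially. \<forall>x\<in>closed_disk av c \<sigma>. av (fps_value av f x - trunc K f x) \<le> \<eta>"
    using f c t \<sigma> \<eta> by (intro trunc_eventually_close_on_disk) auto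
  then obtain K where K: "\<forall>x\<in>closed_disk av c \<sigma>. av (fps_value av f x - trunc K f x) \<le> \<eta>"
    using eventually_happens'[OF sequentially_bot] by blast
  obtain l A where lA: "trunc K f = linear_prod l A" using trunc_eq_linear_prod by blast
  define g where "g s = av l * (\<Prod>\<rho>\<in>#A. max s (av (c - \<rho>)))" for s
  have g: "sup_on (closed_disk av c s) (trunc K f) = g s" if "0 < s" for s
    unfolding g_def lA using that by (rule sup_on_linear_prod)
  have eq: "g s = zeta c s f" if "t \<le> s" "s \<le> \<sigma>" "\<eta> < zeta c s f \<or> \<eta> < g s" for s
    using zeta_eq_sup_on_trunc[OF f c, of s \<eta> K] g[of s] K closed_disk_mono[of s \<sigma> c] that \<eta> t \<sigma> by auto
  have cont: "continuous_on S g" for S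
    unfolding g_def by (intro continuous_intros continuous_on_prod_mset_max)
  have "g t < r" using eq[of t] t \<eta> \<sigma> by linarith
  have "r < g \<sigma>" using eq[of \<sigma>] \<sigma>r \<eta> \<sigma> by simp
  define S where "S = {s \<in> {t..\<sigma>}. g s \<in> {..r}}"
  have "closed {s \<in> {t..\<sigma>}. g s \<le> r}"
    by (intro continuous_on_closed_Collect_le cont continuous_on_const) simp
  hence "compact ({t..\<sigma>} \<inter> {s \<in> {t..\<sigma>}. g s \<le> r})" by (intro compact_Int_closed) simp_all
  also have "{t..\<sigma>} \<inter> {s \<in> {t..\<sigma>}. g s \<le> r} = S" by (auto simp: S_def)
  finally have "compact S" .
  moreover have "t \<in> S" using \<open>g t < r\<close> \<sigma> by (simp add: S_def)
  ultimately obtain s where s: "s \<in> S" "\<And>u. u \<in> S \<Longrightarrow> u \<le> s"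
    using compact_attains_sup[of S] by blast
  have s': "t \<le> s" "s < \<sigma>" "g s \<le> r"
    using s(1) \<open>r < g \<sigma>\<close> by (auto simp: S_def order.strict_iff_order)
  obtain u where u: "s \<le> u" "u \<le> \<sigma>" "g u = r"
    using IVT'[of g s r \<sigma>] s' \<open>r < g \<sigma>\<close> cont by auto
  hence "u = s" using s(2)[of u] s' by (simp add: S_def)
  hence "g s = r" using u by simp
  have gt: "r < zeta c u f" if "s < u" "u < 1" for u
  proof (cases "u \<le> \<sigma>")
    case True
    have "r < g u" using s(2)[of u] that True s' by (force simp: S_def)
    thus ?thesis using eq[of u] \<eta> that True s' by simp
  next
    case False
    have "zeta c \<sigma> f \<le> zeta c u f"
      using False that f c t \<sigma> closed_disk_mono[of \<sigma> u c] by (intro zeta_mono) auto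
    thus ?thesis using \<sigma>r by simp
  qed
  have "maximal_radius f r c s"
    unfolding maximal_radius_def using gt eq[of s] \<open>g s = r\<close> \<eta> s' t \<sigma> by auto
  thus ?thesis using s' by blast
qed

text \<open>
  If the disks meet, one contains the other; the smaller one could then be enlarged to the bigger one without
  exceeding \<open>r\<close>, unless they are equal.
\<close>

lemma maximal_radius_disks_equal:
  assumes "maximal_radius f r c s" "maximal_radius f r d t"
    and "closed_disk av c s \<inter> closed_disk av d t \<noteq> {}"
  shows "s = t" "closed_disk av c s = closed_disk av d t"
proof -
  obtain x where x: "av (x - c) \<le> s" "av (x - d) \<le> t"
    using assms(3) by (auto simp: closed_disk_def)
  have "closed_disk av c s = closed_disk av x s" "closed_disk av d t = closed_disk av x t"
    using x by (auto intro!: closed_disk_recentre simp: av_minus_commute[of _ x])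
  have xc: "closed_disk av c u = closed_disk av x u" if "s \<le> u" for u
    using x that by (intro closed_disk_recentre) (simp add: av_minus_commute[of c])
  have xd: "closed_disk av d u = closed_disk av x u" if "t \<le> u" for u
    using x that by (intro closed_disk_recentre) (simp add: av_minus_commute[of d])
  show "s = t"
  proof (rule ccontr)
    assume "s \<noteq> t"
    then consider "s < t" | "t < s" by linarith
    thus False
    proof cases
      case 1
      hence "r < zeta c t f" "zeta d t f = r" using assms by (auto simp: maximal_radius_def)
      thus False using xc[of t] xd[of t] 1 by (simp add: zeta_def)
    next
      case 2
      hence "r < zeta d s f" "zeta c s f = r" using assms by (auto simp: maximal_radius_def)
      thus False using xc[of s] xd[of s] 2 by (simp add: zeta_def)
    qed
  qed
  thus "closed_disk av c s = closed_disk av d t" using xc xd by simp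
qed

text \<open>
  The supremum of a product of linear factors can only start to grow at a radius at which the disk
  contains a root.
\<close>

lemma maximal_radius_root:
  assumes f: "f \<in> Hinf av" and c: "c \<in> unit_disk av" and m: "maximal_radius f r c s"
    and \<sigma>: "s < \<sigma>" "\<sigma> < 1" "av c \<le> \<sigma>" and \<eta>: "0 \<le> \<eta>" "\<eta> < r"
    and close: "\<And>x. av x \<le> \<sigma> \<Longrightarrow> av (fps_value av f x - trunc K f x) \<le> \<eta>"
    and lA: "trunc K f = linear_prod l A"
  shows "\<exists>\<rho>. \<rho> \<in># A \<and> \<rho> \<in> closed_disk av c s"
proof (rule ccontr)
  assume no_root: "\<not> ?thesis"
  have s: "0 < s" "s < 1" using m by (auto simp: maximal_radius_def)
  \<comment> \<open>Without a root in the disk, the product formula gives the same supremum for the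
    radii \<open>s\<close> and \<open>u > s\<close>.\<close>
  define u where "u = Min (insert \<sigma> ((\<lambda>\<rho>. av (c - \<rho>)) ` set_mset A))"
  have "s < u" unfolding u_def using no_root \<sigma> by (auto simp: closed_disk_def av_minus_commute[of _ c])
  have u: "u \<le> \<sigma>" "\<And>\<rho>. \<rho> \<in># A \<Longrightarrow> u \<le> av (c - \<rho>)" unfolding u_def by auto
  have eq: "sup_on (closed_disk av c t) (trunc K f) = zeta c t f"
    if "s \<le> t" "t \<le> \<sigma>" "\<eta> < zeta c t f" for t
  proof (rule zeta_eq_sup_on_trunc[OF f c])
    show "av (fps_value av f x - trunc K f x) \<le> \<eta>" if "x \<in> closed_disk av c t" for x
      using av_le_if_mem_closed_disk[OF that] \<open>t \<le> \<sigma>\<close> \<sigma> by (intro close) auto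
  qed (use that s \<sigma> \<eta> in auto)
  have "zeta c s f = r" "r < zeta c u f" using m \<open>s < u\<close> u \<sigma> by (auto simp: maximal_radius_def)
  moreover from this have "sup_on (closed_disk av c s) (trunc K f) = zeta c s f"
    "sup_on (closed_disk av c u) (trunc K f) = zeta c u f"
    using \<eta> \<open>s < u\<close> u \<sigma> by (auto intro!: eq)
  moreover have "(\<Prod>\<rho>\<in>#A. max u (av (c - \<rho>))) = (\<Prod>\<rho>\<in>#A. max s (av (c - \<rho>)))"
    using u \<open>s < u\<close> by (intro arg_cong[where f = prod_mset] image_mset_cong) (force simp: max_def)
  ultimately show False using s \<open>s < u\<close> by (simp add: lA sup_on_linear_prod)
qed

text \<open>
  This is the source of regularity. Each of the disjoint disks contains a root of a common truncation of \<open>f\<close>.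
  The supremum \<open>r\<close> on disk \<open>n\<close> is at most the norm of \<open>f\<close> multiplied by the distances of that
  disk from the selected roots of the other disks.
\<close>

lemma prod_dist_ge:
  assumes f: "f \<in> Hinf av" and r: "0 < r" and F: "finite F" "n \<notin> F"
    and z: "\<And>m. m \<in> insert n F \<Longrightarrow> z m \<in> unit_disk av"
    and rad: "\<And>m. m \<in> insert n F \<Longrightarrow> maximal_radius f r (z m) (s m)"
    and disj: "disjoint_family_on (\<lambda>m. closed_disk av (z m) (s m)) (insert n F)"
  shows "r \<le> Hinf_norm av f * (\<Prod>m\<in>F. av (z n - z m))"
proof -
  define S where "S = insert 0 ((\<lambda>m. max (av (z m)) (s m)) ` insert n F)"
  have "finite S" "S \<noteq> {}" using F by (auto simp: S_def)
  moreover have "x < 1" if "x \<in> S" for x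
    using that z rad by (auto simp: S_def unit_disk_def maximal_radius_def)
  ultimately have "Max S < 1" by simp
  then obtain \<sigma> where \<sigma>: "Max S < \<sigma>" "\<sigma> < 1" using dense by blast
  have S\<sigma>: "x < \<sigma>" if "x \<in> S" for x using Max_ge[OF \<open>finite S\<close> that] \<sigma> by linarith
  have "0 < \<sigma>" using S\<sigma> by (simp add: S_def)
  have \<sigma>z: "av (z m) < \<sigma>" "s m < \<sigma>" if "m \<in> insert n F" for m
    using S\<sigma>[of "max (av (z m)) (s m)"] that unfolding S_def by auto
  define \<eta> where "\<eta> = r / 2"
  have \<eta>: "0 < \<eta>" "\<eta> < r" using r by (auto simp: \<eta>_def)
  obtain K where K: "\<And>x. av x \<le> \<sigma> \<Longrightarrow> av (fps_value av f x - trunc K f x) \<le> \<eta>"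
    using eventually_happens'[OF sequentially_bot trunc_eventually_close[OF f, of \<sigma> \<eta>]] \<sigma> \<eta> \<open>0 < \<sigma>\<close>
    by auto
  obtain l A where lA: "trunc K f = linear_prod l A" using trunc_eq_linear_prod by blast
  have "\<exists>\<rho>. \<rho> \<in># A \<and> \<rho> \<in> closed_disk av (z m) (s m)" if "m \<in> insert n F" for m
    using f z[OF that] rad[OF that] \<sigma>z[OF that] \<sigma>(2) \<eta> K lA
    by (intro maximal_radius_root[where \<eta> = \<eta> and \<sigma> = \<sigma> and K = K]) auto
  then obtain w where w: "\<And>m. m \<in> insert n F \<Longrightarrow> w m \<in># A"
    "\<And>m. m \<in> insert n F \<Longrightarrow> w m \<in> closed_disk av (z m) (s m)" by metis
  have "inj_on w F"
    using disj w(2) unfolding disjoint_family_on_def inj_on_def by (metis IntI empty_iff insertCI)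
  have "mset_set (w ` F) \<subseteq># A"
    using w(1) F(1) by (auto simp: subseteq_mset_def count_mset_set')
  then obtain A' where A': "A = mset_set (w ` F) + A'" by (auto simp: subset_mset.le_iff_add)
  have prod_w: "(\<Prod>\<rho>\<in>#mset_set (w ` F). h \<rho>) = (\<Prod>m\<in>F. h (w m))" for h :: "'k \<Rightarrow> real"
    using \<open>inj_on w F\<close> by (simp add: prod_unfold_prod_mset[symmetric] prod.reindex)
  \<comment> \<open>All points of one disk have the same distance from all points of a disjoint
    one.\<close>
  have dist: "max (s n) (av (z n - w m)) = av (z n - z m)" if "m \<in> F" for m
  proof -
    have "closed_disk av (z n) (s n) \<inter> closed_disk av (z m) (s m) = {}"
      using disj that F(2) unfolding disjoint_family_on_def by (metis insertCI)
    moreover have "0 < s n" "0 < s m" using rad that by (auto simp: maximal_radius_def)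
    ultimately have "z m \<notin> closed_disk av (z n) (s n)" "z n \<notin> closed_disk av (z m) (s m)"
      using centre_in_closed_disk[of "s n" "z n"] centre_in_closed_disk[of "s m" "z m"] by auto
    hence *: "s n < av (z n - z m)" "s m < av (z n - z m)"
      by (auto simp: closed_disk_def av_minus_commute[of "z m"])
    moreover have "av (z m - w m) \<le> s m"
      using w(2)[of m] that by (simp add: closed_disk_def av_minus_commute[of "z m"])
    ultimately show ?thesis
      using av_add_eq_max[of "z n - z m" "z m - w m"] by auto
  qed
  \<comment> \<open>Compare the product formulas on disk \<open>n\<close> and on the closed unit disk
    factor by factor: a selected root contributes \<open>av (z n - z m)\<close>, every other root at
    most its factor on the closed unit disk.\<close>
  have n: "0 < s n" "s n < 1" "zeta (z n) (s n) f = r" using rad by (auto simp: maximal_radius_def)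
  have "sup_on (closed_disk av (z n) (s n)) (trunc K f) = zeta (z n) (s n) f"
  proof (rule zeta_eq_sup_on_trunc[OF f])
    show "av (fps_value av f x - trunc K f x) \<le> \<eta>" if "x \<in> closed_disk av (z n) (s n)" for x
      using av_le_if_mem_closed_disk[OF that] \<sigma>z[of n] by (intro K) auto
  qed (use n z \<eta> in auto)
  hence "r = av l * (\<Prod>\<rho>\<in>#A. max (s n) (av (z n - \<rho>)))"
    using n by (simp add: lA sup_on_linear_prod)
  also have "\<dots> = (\<Prod>m\<in>F. av (z n - z m)) * (av l * (\<Prod>\<rho>\<in>#A'. max (s n) (av (z n - \<rho>))))"
    by (simp add: A' prod_w dist)
  finally have r_eq: "r = (\<Prod>m\<in>F. av (z n - z m)) * (av l * (\<Prod>\<rho>\<in>#A'. max (s n) (av (z n - \<rho>))))" .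
  have "av l * (\<Prod>\<rho>\<in>#A'. max (s n) (av (z n - \<rho>))) \<le> av l * (\<Prod>\<rho>\<in>#A'. max 1 (av \<rho>))"
  proof (intro mult_left_mono prod_mset_mono conjI)
    fix \<rho>
    show "max (s n) (av (z n - \<rho>)) \<le> max 1 (av \<rho>)"
      using av_diff_le[of "z n" \<rho>] z[of n] n by (auto simp: unit_disk_def)
  qed (use n av_nonneg in auto)
  also have "\<dots> \<le> av l * (\<Prod>\<rho>\<in>#A. max 1 (av \<rho>))"
  proof -
    have "1 \<le> (\<Prod>m\<in>F. max 1 (av (w m)))" by (intro prod_ge_1) auto
    moreover have "0 \<le> (\<Prod>\<rho>\<in>#A'. max 1 (av \<rho>))" by (intro prod_mset_nonneg) auto
    ultimately have "1 * (\<Prod>\<rho>\<in>#A'. max 1 (av \<rho>)) \<le> (\<Prod>m\<in>F. max 1 (av (w m))) * (\<Prod>\<rho>\<in>#A'. max 1 (av \<rho>))"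
      by (rule mult_right_mono)
    thus ?thesis by (simp add: A' prod_w mult_left_mono av_nonneg)
  qed
  also have "\<dots> = sup_on (closed_disk av 0 1) (trunc K f)"
    by (simp add: lA sup_on_linear_prod av_minus)
  also have "\<dots> \<le> Hinf_norm av f"
    using av_trunc_le[OF f] by (intro sup_on_le closed_disk_nonempty) (auto simp: closed_disk_def)
  finally have "r \<le> (\<Prod>m\<in>F. av (z n - z m)) * Hinf_norm av f"
    unfolding r_eq by (intro mult_left_mono prod_nonneg) (auto simp: av_nonneg)
  thus ?thesis by (simp add: mult.commute)
qed

lemma separation_ge:
  assumes f: "f \<in> Hinf av" and r: "0 < r" and B: "0 < Hinf_norm av f"
    and z: "\<And>m. z m \<in> unit_disk av"
    and rad: "\<And>m. m \<in> C \<Longrightarrow> maximal_radius f r (z m) (s m)"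
    and disj: "disjoint_family_on (\<lambda>m. closed_disk av (z m) (s m)) C" and n: "n \<in> C"
  shows "r / Hinf_norm av f \<le> separation av z C n"
proof (rule LIMSEQ_le_const[OF separation_tendsto[OF z]], intro exI allI impI)
  fix N :: nat
  let ?F = "{m. m < N \<and> m \<in> C \<and> m \<noteq> n}"
  have "insert n ?F \<subseteq> C" using n by auto
  hence "r \<le> Hinf_norm av f * (\<Prod>m\<in>?F. av (z n - z m))"
    using z rad disj by (intro prod_dist_ge[OF f r, where s = s]) (auto intro: disjoint_family_on_mono)
  thus "r / Hinf_norm av f \<le> (\<Prod>m\<in>?F. av (z n - z m))"
    using B by (simp add: field_simps)
qed

section \<open>Growth of coefficients\<close>

lemma coeff_growth_mult:
  assumes "\<And>k. av (fps_nth f k) \<le> a * t ^ k" "\<And>k. av (fps_nth g k) \<le> b * t ^ k" "0 \<le> a" "0 \<le> b" "0 \<le> t"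
  shows "av (fps_nth (f * g) k) \<le> a * b * t ^ k"
  unfolding fps_mult_nth
proof (rule av_sum_le)
  fix i assume i: "i \<in> {0..k}"
  have "av (fps_nth f i * fps_nth g (k - i)) \<le> (a * t ^ i) * (b * t ^ (k - i))"
    unfolding av_mult using assms av_nonneg by (intro mult_mono) auto
  also have "\<dots> = a * b * t ^ (i + (k - i))" by (simp only: power_add mult_ac)
  also have "i + (k - i) = k" using i by simp
  finally show "av (fps_nth f i * fps_nth g (k - i)) \<le> a * b * t ^ k" .
qed (use assms in auto)

lemma Hinf_normI:
  assumes "\<And>k. av (fps_nth f k) \<le> B"
  shows "f \<in> Hinf av" "Hinf_norm av f \<le> B"
  using assms by (auto simp: Hinf_def Hinf_norm_def intro!: bdd_aboveI2 cSUP_least)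

lemma Hinf_norm_mult_le:
  assumes "f \<in> Hinf av" "g \<in> Hinf av"
  shows "Hinf_norm av (f * g) \<le> Hinf_norm av f * Hinf_norm av g"
  using coeff_growth_mult[of f "Hinf_norm av f" 1 g "Hinf_norm av g"] assms
  by (intro Hinf_normI) (auto simp: av_coeff_le_norm Hinf_norm_nonneg)

lemma Hinf_norm_1_le: "Hinf_norm av 1 \<le> 1"
  by (rule Hinf_normI) (simp add: av_0 av_1)

lemma Hinf_power: "f \<in> Hinf av \<Longrightarrow> f ^ n \<in> Hinf av"
  by (induction n) (auto simp: Hinf_1 Hinf_mult)

lemma Hinf_norm_power_le:
  assumes "f \<in> Hinf av"
  shows "Hinf_norm av (f ^ n) \<le> Hinf_norm av f ^ n"
proof (induction n)
  case 0
  show ?case using Hinf_norm_1_le by simp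
next
  case (Suc n)
  have "Hinf_norm av (f ^ Suc n) \<le> Hinf_norm av f * Hinf_norm av (f ^ n)"
    using assms by (auto intro!: Hinf_norm_mult_le Hinf_power)
  also have "\<dots> \<le> Hinf_norm av f * Hinf_norm av f ^ n"
    using Suc assms Hinf_norm_nonneg by (intro mult_left_mono) auto
  finally show ?case by simp
qed

lemma fps_value_power:
  assumes "f \<in> Hinf av" "x \<in> unit_disk av"
  shows "fps_value av (f ^ n) x = fps_value av f x ^ n"
  by (induction n) (use assms in \<open>auto simp: fps_value_1 fps_value_mult Hinf_power\<close>)

text \<open>
  Congruence to \<open>1\<close> modulo \<open>fps_X ^ L\<close>.
\<close>

definition one_upto :: "nat \<Rightarrow> 'k fps \<Rightarrow> bool" where
  "one_upto L f \<longleftrightarrow> (\<forall>k<L. fps_nth f k = fps_nth 1 k)"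

lemma fps_nth_mult_one_upto:
  assumes "one_upto L g" "k < L"
  shows "fps_nth (f * g) k = fps_nth f k"
proof -
  have "fps_nth (f * g) k = fps_nth (f * 1) k"
    unfolding fps_mult_nth using assms by (intro sum.cong) (auto simp: one_upto_def)
  thus ?thesis by simp
qed

lemma one_upto_power: "one_upto L f \<Longrightarrow> one_upto L (f ^ n)"
proof (induction n)
  case (Suc n)
  thus ?case using fps_nth_mult_one_upto[of L f _ "f ^ n"] by (simp add: one_upto_def mult.commute)
qed (simp add: one_upto_def)

text \<open>
  The recursion for the coefficients of the reciprocal preserves the bound, since the ultrametric
  inequality makes sums harmless.
\<close>

lemma av_inverse_coeff_le:
  assumes "fps_nth f 0 = 1" "\<And>k. av (fps_nth f k) \<le> t ^ k" "0 \<le> t"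
  shows "av (fps_nth (inverse f) n) \<le> t ^ n"
proof (induction n rule: less_induct)
  case (less n)
  show ?case
  proof (cases "n = 0")
    case True
    thus ?thesis using assms by (simp add: av_1)
  next
    case False
    let ?S = "\<Sum>i<n. fps_nth (inverse f) i * fps_nth f (n - i)"
    have "inverse f * f = 1" using assms by (intro inverse_mult_eq_1) simp
    hence "0 = fps_nth (inverse f * f) n" using False by simp
    also have "\<dots> = (\<Sum>i<n. fps_nth (inverse f) i * fps_nth f (n - i)) + fps_nth (inverse f) n"
      unfolding fps_mult_nth atLeast0AtMost
      by (simp add: assms(1) flip: lessThan_Suc_atMost)
    finally have "?S + fps_nth (inverse f) n = 0" by simp
    hence "fps_nth (inverse f) n = - ?S" by (rule minus_unique[symmetric])
    hence "av (fps_nth (inverse f) n) = av ?S" by (simp only: av_minus)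
    also have "av ?S \<le> t ^ n"
    proof (rule av_sum_le)
      fix i assume i: "i \<in> {..<n}"
      have "av (fps_nth (inverse f) i * fps_nth f (n - i)) \<le> t ^ i * t ^ (n - i)"
        unfolding av_mult using less i assms av_nonneg by (intro mult_mono) auto
      thus "av (fps_nth (inverse f) i * fps_nth f (n - i)) \<le> t ^ n"
        using i by (simp flip: power_add)
    qed (use assms in auto)
    finally show ?thesis .
  qed
qed

text \<open>
  A truncated reciprocal turns \<open>V\<close> into a series that starts like \<open>1\<close>. Truncation keeps the norm
  of the multiplier bounded, by a constant that is close to \<open>1\<close> if \<open>t\<close> is close to \<open>1\<close> and \<open>L\<close> is
  fixed.
\<close>

lemma ex_inverse_upto:
  assumes V: "fps_nth V 0 = 1" "\<And>k. av (fps_nth V k) \<le> t ^ k" and t: "1 \<le> t"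
  shows "\<exists>U. one_upto L (V * U) \<and> U \<in> Hinf av \<and> Hinf_norm av U \<le> t ^ L"
proof (intro exI conjI)
  let ?U = "fps_cutoff L (inverse V)"
  have "V * inverse V = 1" using V by (intro inverse_mult_eq_1') simp
  moreover have "fps_nth (V * ?U) k = fps_nth (V * inverse V) k" if "k < L" for k
    unfolding fps_mult_nth using that by (intro sum.cong) auto
  ultimately show "one_upto L (V * ?U)" by (simp add: one_upto_def)
  have "av (fps_nth ?U k) \<le> t ^ L" for k
  proof (cases "k < L")
    case True
    have "av (fps_nth (inverse V) k) \<le> t ^ k" using V t by (intro av_inverse_coeff_le) auto
    also have "\<dots> \<le> t ^ L" using True t by (intro power_increasing) auto
    finally show ?thesis using True by simp
  qed (use t in \<open>simp add: av_0\<close>)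
  thus "?U \<in> Hinf av" "Hinf_norm av ?U \<le> t ^ L" using Hinf_normI by blast+
qed

definition root_factor :: "'k \<Rightarrow> 'k fps" where
  "root_factor \<rho> = 1 - fps_const (inverse \<rho>) * fps_X"

lemma root_factor_nth:
  "fps_nth (root_factor \<rho>) k = (if k = 0 then 1 else if k = 1 then - inverse \<rho> else 0)"
  by (auto simp: root_factor_def)

lemma fps_value_root_factor: "fps_value av (root_factor \<rho>) x = 1 - x / \<rho>"
proof (rule fps_value_eqI_bound)
  let ?e = "\<lambda>n::nat. if n < 2 then av (trunc n (root_factor \<rho>) x - (1 - x / \<rho>)) else 0"
  show "?e \<longlonglongrightarrow> 0"
    by (rule tendsto_eventually) (auto intro: eventually_sequentiallyI[of 2])
  fix n
  have "trunc n (root_factor \<rho>) x = 1 - x / \<rho>" if "n \<ge> 2"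
  proof -
    define m where "m = n - 2"
    have "n = Suc (Suc m)" using that by (simp add: m_def)
    thus ?thesis unfolding trunc_def
      by (simp add: root_factor_nth sum.lessThan_Suc_shift divide_inverse mult.commute del: sum.lessThan_Suc)
  qed
  thus "av (trunc n (root_factor \<rho>) x - (1 - x / \<rho>)) \<le> ?e n" by (simp add: av_0)
qed

lemma root_factor_growth:
  assumes "1 \<le> a" "av (inverse \<rho>) \<le> a * t"
  shows "av (fps_nth (root_factor \<rho>) k) \<le> a * t ^ k"
proof -
  have "0 \<le> a * t" using assms(2) av_nonneg[of "inverse \<rho>"] by linarith
  hence "0 \<le> t" using assms(1) by (simp add: zero_le_mult_iff)
  thus ?thesis using assms by (auto simp: root_factor_nth av_0 av_1 av_minus)
qed

text \<open>
  The freedom in \<open>a\<close> and \<open>t\<close> serves two purposes: \<open>a = 1\<close> with \<open>t > 1\<close> describes a product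
  that has no zeros close to \<open>0\<close>, and \<open>t = 1\<close> bounds the norm.
\<close>

lemma root_product_growth:
  assumes "\<And>\<rho>. \<rho> \<in># A \<Longrightarrow> 1 \<le> a \<rho> \<and> av (inverse \<rho>) \<le> a \<rho> * t" "0 \<le> t"
  shows "av (fps_nth (\<Prod>\<rho>\<in>#A. root_factor \<rho>) k) \<le> (\<Prod>\<rho>\<in>#A. a \<rho>) * t ^ k"
  using assms(1)
proof (induction A arbitrary: k)
  case empty
  show ?case using assms(2) by (auto simp: av_0 av_1)
next
  case (add \<rho> A)
  have 1: "1 \<le> a \<rho>" "0 \<le> a \<rho>" "av (inverse \<rho>) \<le> a \<rho> * t" using add.prems[of \<rho>] by fastforce+
  have 2: "0 \<le> a x" if "x \<in># A" for x using add.prems[of x] that by fastforce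
  have "av (fps_nth (root_factor \<rho> * (\<Prod>\<rho>\<in>#A. root_factor \<rho>)) k) \<le> a \<rho> * (\<Prod>\<rho>\<in>#A. a \<rho>) * t ^ k"
    using 1 2 add assms(2) by (intro coeff_growth_mult root_factor_growth prod_mset_nonneg) auto
  thus ?case by simp
qed

lemma root_product_nth_0: "fps_nth (\<Prod>\<rho>\<in>#A. root_factor \<rho>) 0 = 1"
  by (induction A) (auto simp: root_factor_nth)

lemma fps_value_root_product:
  assumes "x \<in> unit_disk av"
  shows "(\<Prod>\<rho>\<in>#A. root_factor \<rho>) \<in> Hinf av \<and>
    fps_value av (\<Prod>\<rho>\<in>#A. root_factor \<rho>) x = (\<Prod>\<rho>\<in>#A. 1 - x / \<rho>)"
proof (induction A)
  case (add \<rho> A)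
  have "root_factor \<rho> \<in> Hinf av"
    by (rule Hinf_normI(1)[where B = "max 1 (av (inverse \<rho>))"])
      (auto simp: root_factor_nth av_minus av_0 av_1)
  thus ?case using add assms by (simp add: Hinf_mult fps_value_mult fps_value_root_factor)
qed (simp add: Hinf_1 fps_value_1)

section \<open>Functions that are small near the boundary\<close>

text \<open>
  The factor is \<open>V * U\<close>, where \<open>V\<close> is a truncation of \<open>f\<close> stripped of its zeros in the disk of
  radius \<open>\<sigma>\<close> and normalised at \<open>0\<close>, and \<open>U\<close> is an initial piece of the reciprocal of \<open>V\<close>. The
  hypothesis that \<open>f\<close> nearly attains its norm on the disk of radius \<open>\<sigma>\<close> forces \<open>\<sigma> ^ N\<close> to
  be at least \<open>\<alpha>\<close>, where \<open>N\<close> is the number of the zeros removed; so their removal costs at most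
  a factor \<open>1 / \<alpha>\<close>, uniformly in the degree of truncation. The parameter \<open>\<tau>\<close> delimits the
  region in which the truncation is close to \<open>f\<close>.
\<close>

lemma ex_near_unit_factor:
  assumes f: "f \<in> Hinf av" and r: "0 < r" "r < \<alpha> * Hinf_norm av f"
    and \<sigma>: "0 < \<sigma>" "\<sigma> < 1" "\<alpha> * Hinf_norm av f < zeta 0 \<sigma> f" "\<alpha> < \<sigma> ^ L"
    and \<alpha>: "0 < \<alpha>" and \<tau>: "\<tau> < 1"
  shows "\<exists>H\<in>Hinf av. one_upto L H \<and> Hinf_norm av H \<le> (1 / \<alpha>)\<^sup>2 \<and>
    (\<forall>c s x. \<sigma> < av c \<and> av c \<le> \<tau> \<and> 0 < s \<and> s < 1 \<and> zeta c s f \<le> r \<and> x \<in> closed_disk av c s \<longrightarrow>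
       av (fps_value av H x) \<le> r / Hinf_norm av f * (1 / \<alpha>)\<^sup>2)"
proof -
  define B where "B = Hinf_norm av f"
  have "0 < \<alpha> * B" using r by (simp add: B_def)
  hence "0 < B" using \<alpha> by (simp add: zero_less_mult_iff)
  have 0: "0 \<in> unit_disk av" by (simp add: unit_disk_def av_0)
  define \<tau>' where "\<tau>' = max \<sigma> \<tau>"
  have \<tau>': "0 \<le> \<tau>'" "\<tau>' < 1" using \<sigma> \<tau> by (auto simp: \<tau>'_def)
  obtain K where K: "\<And>x. av x \<le> \<tau>' \<Longrightarrow> av (fps_value av f x - trunc K f x) \<le> r"
    using eventually_happens'[OF sequentially_bot trunc_eventually_close[OF f \<tau>' r(1)]] by auto
  obtain l A where lA: "trunc K f = linear_prod l A" using trunc_eq_linear_prod by blast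
  \<comment> \<open>\<open>A1\<close> collects the roots in the disk of radius \<open>\<sigma>\<close>.
    Normalised by its value at \<open>0\<close>, the product over the other roots \<open>A2\<close> is
    the polynomial \<open>V\<close> below.\<close>
  define A1 where "A1 = filter_mset (\<lambda>\<rho>. av \<rho> \<le> \<sigma>) A"
  define A2 where "A2 = filter_mset (\<lambda>\<rho>. \<not> av \<rho> \<le> \<sigma>) A"
  have A1: "av \<rho> \<le> \<sigma>" if "\<rho> \<in># A1" for \<rho> using that by (simp add: A1_def)
  have A2: "\<sigma> < av \<rho>" if "\<rho> \<in># A2" for \<rho> using that by (simp add: A2_def)
  have split: "(\<Prod>\<rho>\<in>#A. g \<rho>) = (\<Prod>\<rho>\<in>#A1. g \<rho>) * (\<Prod>\<rho>\<in>#A2. g \<rho>)" for g :: "'k \<Rightarrow> real"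
    unfolding A1_def A2_def by (rule prod_mset_filter)
  define P where "P = (\<Prod>\<rho>\<in>#A2. av \<rho>)"
  have "\<sigma> ^ size A2 \<le> P" unfolding P_def using A2 \<sigma> by (intro prod_mset_ge_power) (auto intro: less_imp_le)
  hence "0 < P" using zero_less_power[OF \<sigma>(1), of "size A2"] by linarith
  define N where "N = size A1"
  have \<sigma>N: "0 < \<sigma> ^ N" "\<sigma> ^ N \<le> 1" using \<sigma> by (auto intro: power_le_one)

  \<comment> \<open>On the disk of radius \<open>\<sigma>\<close> each root in \<open>A1\<close>
    contributes the factor \<open>\<sigma>\<close> and each root in \<open>A2\<close> its absolute
    value.\<close>
  have "sup_on (closed_disk av 0 \<sigma>) (trunc K f) = zeta 0 \<sigma> f"
  proof (rule zeta_eq_sup_on_trunc[OF f 0])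
    show "av (fps_value av f x - trunc K f x) \<le> r" if "x \<in> closed_disk av 0 \<sigma>" for x
      using that by (intro K) (auto simp: closed_disk_def \<tau>'_def)
  qed (use \<sigma> r in auto)
  hence "zeta 0 \<sigma> f = av l * (\<Prod>\<rho>\<in>#A1. max \<sigma> (av \<rho>)) * (\<Prod>\<rho>\<in>#A2. max \<sigma> (av \<rho>))"
    using \<sigma> by (simp add: lA sup_on_linear_prod av_minus split)
  also have "(\<Prod>\<rho>\<in>#A1. max \<sigma> (av \<rho>)) = (\<Prod>\<rho>\<in>#A1. \<sigma>)"
    using A1 by (intro arg_cong[where f = prod_mset] image_mset_cong) auto
  also have "\<dots> = \<sigma> ^ N" by (simp add: N_def)
  also have "(\<Prod>\<rho>\<in>#A2. max \<sigma> (av \<rho>)) = P"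
    unfolding P_def using A2 by (intro arg_cong[where f = prod_mset] image_mset_cong) force
  finally have lower: "\<alpha> * B < av l * \<sigma> ^ N * P" using \<sigma> by (simp add: B_def)
  have "av l \<noteq> 0" using lower \<open>0 < \<alpha> * B\<close> by auto
  hence "0 < av l" using av_nonneg[of l] by linarith
  have "av l * \<sigma> ^ N * P \<le> av l * 1 * P"
    using \<sigma>N \<open>0 < av l\<close> \<open>0 < P\<close> by (intro mult_mono mult_nonneg_nonneg) auto
  hence lower': "\<alpha> * B < av l * P" using lower by simp

  have "av l * (\<Prod>\<rho>\<in>#A1. max 1 (av \<rho>)) * (\<Prod>\<rho>\<in>#A2. max 1 (av \<rho>)) = sup_on (closed_disk av 0 1) (trunc K f)"
    by (simp add: lA sup_on_linear_prod av_minus split)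
  also have "\<dots> \<le> B"
    unfolding B_def using av_trunc_le[OF f] by (intro sup_on_le closed_disk_nonempty) (auto simp: closed_disk_def)
  also have "(\<Prod>\<rho>\<in>#A1. max 1 (av \<rho>)) = (\<Prod>\<rho>\<in>#A1. 1)"
    using A1 \<sigma> by (intro arg_cong[where f = prod_mset] image_mset_cong) fastforce
  finally have upper: "av l * (\<Prod>\<rho>\<in>#A2. max 1 (av \<rho>)) \<le> B" by simp

  define V where "V = (\<Prod>\<rho>\<in>#A2. root_factor \<rho>)"
  have "V \<in> Hinf av" unfolding V_def using fps_value_root_product[OF 0] by blast
  have V_growth: "av (fps_nth V k) \<le> (1 / \<sigma>) ^ k" for k
  proof -
    have "av (inverse \<rho>) \<le> 1 / \<sigma>" if "\<rho> \<in># A2" for \<rho>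
      using A2[OF that] \<sigma> by (simp add: av_inverse divide_inverse le_imp_inverse_le)
    thus ?thesis using root_product_growth[of A2 "\<lambda>_. 1" "1 / \<sigma>" k] \<sigma> by (simp add: V_def)
  qed
  have V_norm: "Hinf_norm av V \<le> 1 / \<alpha>"
  proof (rule Hinf_normI)
    fix k
    have "av (fps_nth V k) \<le> (\<Prod>\<rho>\<in>#A2. max 1 (av \<rho>) / av \<rho>)"
    proof -
      have "1 \<le> max 1 (av \<rho>) / av \<rho> \<and> av (inverse \<rho>) \<le> max 1 (av \<rho>) / av \<rho>" if "\<rho> \<in># A2" for \<rho>
      proof -
        have "0 < av \<rho>" using A2[OF that] \<sigma> by linarith
        moreover have "av (inverse \<rho>) = 1 / av \<rho>" by (simp add: av_inverse divide_inverse)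
        ultimately show ?thesis by (simp add: divide_right_mono)
      qed
      thus ?thesis using root_product_growth[of A2 "\<lambda>\<rho>. max 1 (av \<rho>) / av \<rho>" 1 k] by (simp add: V_def)
    qed
    also have "\<dots> = (av l * (\<Prod>\<rho>\<in>#A2. max 1 (av \<rho>))) / (av l * P)"
      using \<open>0 < av l\<close> by (simp add: prod_mset_divide P_def)
    also have "\<dots> \<le> B / (\<alpha> * B)"
      using upper lower' \<open>0 < \<alpha> * B\<close> \<open>0 < B\<close> by (intro frac_le) auto
    also have "\<dots> = 1 / \<alpha>" using \<open>0 < B\<close> by simp
    finally show "av (fps_nth V k) \<le> 1 / \<alpha>" .
  qed
  have "1 \<le> 1 / \<sigma>" using \<sigma> by simp
  then obtain U where U: "one_upto L (V * U)" "U \<in> Hinf av" "Hinf_norm av U \<le> (1 / \<sigma>) ^ L"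
    using ex_inverse_upto[of V "1 / \<sigma>" L] V_growth root_product_nth_0[of A2] by (auto simp: V_def)
  have "(1 / \<sigma>) ^ L \<le> 1 / \<alpha>"
    using \<sigma> \<alpha> by (simp add: power_one_over frac_le divide_simps)
  hence U_norm: "Hinf_norm av U \<le> 1 / \<alpha>" using U by simp
  show ?thesis
  proof (intro bexI[of _ "V * U"] conjI allI impI)
    show "V * U \<in> Hinf av" using \<open>V \<in> Hinf av\<close> U by (intro Hinf_mult)
    show "one_upto L (V * U)" by (rule U)
    have "Hinf_norm av (V * U) \<le> Hinf_norm av V * Hinf_norm av U"
      using \<open>V \<in> Hinf av\<close> U by (intro Hinf_norm_mult_le)
    also have "\<dots> \<le> 1 / \<alpha> * (1 / \<alpha>)"
      using V_norm U_norm U \<alpha> Hinf_norm_nonneg by (intro mult_mono) auto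
    finally show "Hinf_norm av (V * U) \<le> (1 / \<alpha>)\<^sup>2" by (simp add: power2_eq_square)
  next
    fix c s x
    assume "\<sigma> < av c \<and> av c \<le> \<tau> \<and> 0 < s \<and> s < 1 \<and> zeta c s f \<le> r \<and> x \<in> closed_disk av c s"
    hence c: "\<sigma> < av c" "av c \<le> \<tau>" and s: "0 < s" "s < 1" "zeta c s f \<le> r"
      and x: "x \<in> closed_disk av c s" by auto
    have cu: "c \<in> unit_disk av" using c \<tau> by (simp add: unit_disk_def)
    have xu: "x \<in> unit_disk av" using closed_disk_subset_unit_disk[OF cu s(2)] x by blast
    \<comment> \<open>Otherwise the disk would contain the disk of radius \<open>\<sigma>\<close> around
      \<open>0\<close>, on which \<open>f\<close> exceeds \<open>r\<close>.\<close>
    have "s < av c"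
    proof (rule ccontr)
      assume "\<not> s < av c"
      hence "av (c - 0) \<le> s" by simp
      hence "closed_disk av c s = closed_disk av 0 s" by (rule closed_disk_recentre)
      hence "zeta 0 \<sigma> f \<le> zeta c s f"
        using f cu s \<sigma> c \<open>\<not> s < av c\<close> closed_disk_mono[of \<sigma> s 0] by (intro zeta_mono) auto
      thus False using s \<sigma> r by linarith
    qed
    have "sup_on (closed_disk av c s) (trunc K f) \<le> max (zeta c s f) r"
      unfolding zeta_def
    proof (intro sup_on_perturb_le closed_disk_nonempty bounded_fps_value f cu s)
      fix y assume "y \<in> closed_disk av c s"
      hence "av y \<le> \<tau>'" using av_le_if_mem_closed_disk[of y c s] \<open>s < av c\<close> c by (simp add: \<tau>'_def)
      thus "av (fps_value av f y - trunc K f y) \<le> r" by (rule K)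
    qed
    hence T_le: "av l * (\<Prod>\<rho>\<in>#A1. max s (av (c - \<rho>))) * (\<Prod>\<rho>\<in>#A2. max s (av (c - \<rho>))) \<le> r"
      using s by (simp add: lA sup_on_linear_prod split)
    define Y where "Y = (\<Prod>\<rho>\<in>#A2. max s (av (c - \<rho>)))"
    have "0 \<le> Y" unfolding Y_def by (intro prod_mset_nonneg) (simp add: av_nonneg le_max_iff_disj)
    have "\<sigma> ^ N \<le> (\<Prod>\<rho>\<in>#A1. max s (av (c - \<rho>)))"
      unfolding N_def
    proof (rule prod_mset_ge_power)
      fix \<rho> assume "\<rho> \<in># A1"
      hence "av (c - \<rho>) = av c"
        using av_add_eq_max[of c "- \<rho>"] A1[of \<rho>] c by (simp add: av_minus)
      thus "\<sigma> \<le> max s (av (c - \<rho>))" using c by simp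
    qed (use \<sigma> in simp)
    hence "av l * \<sigma> ^ N * Y \<le> av l * (\<Prod>\<rho>\<in>#A1. max s (av (c - \<rho>))) * Y"
      using \<open>0 < av l\<close> \<open>0 \<le> Y\<close> by (intro mult_right_mono mult_left_mono) auto
    hence Y: "av l * \<sigma> ^ N * Y \<le> r" using T_le by (simp add: Y_def)
    have "av (fps_value av V x) = (\<Prod>\<rho>\<in>#A2. av (1 - x / \<rho>))"
      using fps_value_root_product[OF xu, of A2] by (simp add: V_def av_prod_mset)
    also have "\<dots> \<le> (\<Prod>\<rho>\<in>#A2. max s (av (c - \<rho>)) / av \<rho>)"
    proof (intro prod_mset_mono conjI)
      fix \<rho> assume "\<rho> \<in># A2"
      hence \<rho>: "0 < av \<rho>" "\<rho> \<noteq> 0" using A2[of \<rho>] \<sigma> by (auto simp: av_0)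
      have "1 - x / \<rho> = (\<rho> - x) / \<rho>" using \<rho> by (simp add: divide_simps)
      hence "av (1 - x / \<rho>) = av (x - \<rho>) / av \<rho>"
        by (simp add: av_divide av_minus_commute[of \<rho>])
      moreover have "av (x - \<rho>) \<le> max s (av (c - \<rho>))"
        using av_ultrametric[of "x - c" "c - \<rho>"] x by (simp add: closed_disk_def)
      ultimately show "av (1 - x / \<rho>) \<le> max s (av (c - \<rho>)) / av \<rho>"
        using \<rho> by (simp add: divide_right_mono)
    qed (rule av_nonneg)
    also have "\<dots> = (av l * \<sigma> ^ N * Y) / (av l * \<sigma> ^ N * P)"
      using \<open>0 < av l\<close> \<sigma> by (simp add: prod_mset_divide P_def Y_def)
    also have "\<dots> \<le> r / (\<alpha> * B)"
      using Y lower \<open>0 < \<alpha> * B\<close> r by (intro frac_le) auto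
    finally have V_le: "av (fps_value av V x) \<le> r / (\<alpha> * B)" .
    have "av (fps_value av (V * U) x) = av (fps_value av V x) * av (fps_value av U x)"
      using \<open>V \<in> Hinf av\<close> U xu by (simp add: fps_value_mult av_mult)
    also have "\<dots> \<le> r / (\<alpha> * B) * (1 / \<alpha>)"
      using V_le Hinf_sums_to(2)[OF U(2) xu] U_norm r \<open>0 < \<alpha> * B\<close> av_nonneg
      by (intro mult_mono) auto
    also have "\<dots> = r / B * (1 / \<alpha>)\<^sup>2" by (simp add: power2_eq_square)
    finally show "av (fps_value av (V * U) x) \<le> r / Hinf_norm av f * (1 / \<alpha>)\<^sup>2"
      by (simp add: B_def)
  qed
qed

text \<open>
  The bound of \<open>ex_near_unit_factor\<close> on the disks stays away from \<open>1\<close> as \<open>\<alpha>\<close> tends to \<open>1\<close>,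
  while the bound for the norm tends to \<open>1\<close>. So powers are arbitrarily small on the disks, at a cost
  in norm that is arbitrarily close to \<open>1\<close>.
\<close>

lemma eventually_ex_damping_factor:
  assumes f: "f \<in> Hinf av" and r: "0 < r" "r < Hinf_norm av f" and q: "0 < q" and M: "1 < M"
  shows "\<forall>\<^sub>F \<sigma> in at_left 1. \<forall>\<tau><1. \<exists>H\<in>Hinf av. one_upto L H \<and> Hinf_norm av H \<le> M \<and>
    (\<forall>c s. \<sigma> < av c \<and> av c \<le> \<tau> \<and> 0 < s \<and> s < 1 \<and> zeta c s f \<le> r \<longrightarrow> zeta c s H \<le> q)"
proof -
  define B where "B = Hinf_norm av f"
  have B: "0 < B" "0 < r / B" "r / B < 1" using r by (auto simp: B_def)
  \<comment> \<open>The exponent \<open>n\<close> makes the factor small on the disks; only then is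
    \<open>\<alpha>\<close> taken so close to \<open>1\<close> that the \<open>n\<close>-th power still
    has norm at most \<open>M\<close>.\<close>
  obtain n where n: "(r / B) ^ n < q / M"
    using real_arch_pow_inv[of "q / M" "r / B"] B q M by auto
  have "isCont (\<lambda>a. ((1 / a)\<^sup>2) ^ n) (1::real)" by (intro continuous_intros) auto
  hence "((\<lambda>a. ((1 / a)\<^sup>2) ^ n) \<longlongrightarrow> 1) (at_left (1::real))"
    by (simp add: isCont_def filterlim_at_split)
  hence "\<forall>\<^sub>F a in at_left (1::real). ((1 / a)\<^sup>2) ^ n < M" using M by (rule order_tendstoD)
  moreover have "\<forall>\<^sub>F a in at_left (1::real). a \<in> {r / B<..<1}"
    using B by (intro eventually_at_leftI[of "r / B"]) auto
  ultimately have "\<forall>\<^sub>F a in at_left (1::real). ((1 / a)\<^sup>2) ^ n < M \<and> a \<in> {r / B<..<1}"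
    by (rule eventually_conj)
  then obtain \<alpha> where \<alpha>: "((1 / \<alpha>)\<^sup>2) ^ n < M" "r / B < \<alpha>" "\<alpha> < 1"
    using eventually_happens'[OF trivial_limit_at_left_real] by fastforce
  have "0 < \<alpha>" using \<alpha> B by linarith
  have r\<alpha>: "r < \<alpha> * B" using \<alpha>(2) B by (simp add: field_simps)
  have "\<alpha> * B < B" using \<alpha> B by simp
  hence 1: "\<forall>\<^sub>F \<sigma> in at_left 1. \<alpha> * B < zeta 0 \<sigma> f"
    by (intro eventually_zeta_gt f) (simp add: B_def)
  have "isCont (\<lambda>t. t ^ L) (1::real)" by simp
  hence "((\<lambda>t. t ^ L) \<longlongrightarrow> 1) (at_left (1::real))" by (simp add: isCont_def filterlim_at_split)
  hence 2: "\<forall>\<^sub>F \<sigma> in at_left 1. \<alpha> < \<sigma> ^ L" using \<alpha>(3) by (rule order_tendstoD)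
  have 3: "\<forall>\<^sub>F \<sigma> in at_left 1. \<sigma> \<in> {0<..<(1::real)}" by (rule eventually_at_leftI[of 0]) auto
  from 1 2 3 show ?thesis
  proof (eventually_elim, intro allI impI)
    fix \<sigma> \<tau> :: real
    assume \<sigma>: "\<alpha> * B < zeta 0 \<sigma> f" "\<alpha> < \<sigma> ^ L" "\<sigma> \<in> {0<..<1}" and \<tau>: "\<tau> < 1"
    obtain H where H: "H \<in> Hinf av" "one_upto L H" "Hinf_norm av H \<le> (1 / \<alpha>)\<^sup>2"
      "\<And>c s x. \<lbrakk>\<sigma> < av c; av c \<le> \<tau>; 0 < s; s < 1; zeta c s f \<le> r; x \<in> closed_disk av c s\<rbrakk> \<Longrightarrow>
         av (fps_value av H x) \<le> r / B * (1 / \<alpha>)\<^sup>2"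
      using ex_near_unit_factor[OF f r(1), of \<alpha> \<sigma> L \<tau>] r\<alpha> \<sigma> \<open>0 < \<alpha>\<close> \<tau> unfolding B_def by auto
    have norm: "Hinf_norm av (H ^ n) \<le> M"
    proof -
      have "Hinf_norm av (H ^ n) \<le> Hinf_norm av H ^ n" using H by (intro Hinf_norm_power_le)
      also have "\<dots> \<le> ((1 / \<alpha>)\<^sup>2) ^ n" using H Hinf_norm_nonneg by (intro power_mono) auto
      finally show ?thesis using \<alpha> by simp
    qed
    have "zeta c s (H ^ n) \<le> q"
      if cs: "\<sigma> < av c" "av c \<le> \<tau>" "0 < s" "s < 1" "zeta c s f \<le> r" for c s
    proof (rule zeta_le[OF cs(3)])
      fix x assume x: "x \<in> closed_disk av c s"
      have "c \<in> unit_disk av" using cs \<tau> by (simp add: unit_disk_def)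
      hence xu: "x \<in> unit_disk av" using closed_disk_subset_unit_disk cs(4) x by blast
      have "av (fps_value av (H ^ n) x) = av (fps_value av H x) ^ n"
        using H xu by (simp add: fps_value_power av_power)
      also have "\<dots> \<le> (r / B * (1 / \<alpha>)\<^sup>2) ^ n"
        using H(4)[OF cs x] av_nonneg by (intro power_mono) auto
      also have "\<dots> = (r / B) ^ n * ((1 / \<alpha>)\<^sup>2) ^ n" by (rule power_mult_distrib)
      also have "\<dots> \<le> q / M * M"
        using n \<alpha> B q M by (intro mult_mono) auto
      finally show "av (fps_value av (H ^ n) x) \<le> q" using M by simp
    qed
    thus "\<exists>H\<in>Hinf av. one_upto L H \<and> Hinf_norm av H \<le> M \<and>
      (\<forall>c s. \<sigma> < av c \<and> av c \<le> \<tau> \<and> 0 < s \<and> s < 1 \<and> zeta c s f \<le> r \<longrightarrow> zeta c s H \<le> q)"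
      using H norm by (intro bexI[of _ "H ^ n"]) (auto intro: one_upto_power Hinf_power)
  qed
qed

text \<open>
  The infinite product of factors that agree with \<open>1\<close> to increasing order, so that each coefficient of
  the partial products becomes stationary.
\<close>

definition infprod :: "(nat \<Rightarrow> 'k fps) \<Rightarrow> 'k fps" where
  "infprod F = Abs_fps (\<lambda>n. fps_nth (\<Prod>j<Suc n. F j) n)"

lemma infprod_nth:
  assumes "\<And>j. one_upto (Suc j) (F j)" "n < N"
  shows "fps_nth (infprod F) n = fps_nth (\<Prod>j<N. F j) n"
proof -
  have "Suc n \<le> N" using assms(2) by simp
  thus ?thesis
  proof (induction N rule: dec_induct)
    case base
    show ?case by (simp add: infprod_def)
  next
    case (step m)
    thus ?case using fps_nth_mult_one_upto[OF assms(1)[of m], of n "\<Prod>j<m. F j"] by simp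
  qed
qed

lemma infprod_nth_0:
  assumes "\<And>j. one_upto (Suc j) (F j)"
  shows "fps_nth (infprod F) 0 = 1"
  using assms[of 0] by (simp add: infprod_def one_upto_def)

lemma infprod_remove_factor:
  assumes F: "\<And>j. one_upto (Suc j) (F j)"
  shows "infprod F = F i * infprod (F(i := 1))"
proof (rule fps_ext)
  fix n
  have F': "one_upto (Suc j) ((F(i := 1)) j)" for j using F by (simp add: one_upto_def)
  define N where "N = Suc (max n i)"
  have "(\<Prod>j<N. F j) = F i * (\<Prod>j\<in>{..<N} - {i}. F j)"
    by (subst prod.remove[of _ i]) (auto simp: N_def)
  also have "(\<Prod>j\<in>{..<N} - {i}. F j) = (\<Prod>j<N. (F(i := 1)) j)"
    by (subst (2) prod.remove[of _ i]) (auto simp: N_def intro!: prod.cong)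
  finally have "(\<Prod>j<N. F j) = F i * (\<Prod>j<N. (F(i := 1)) j)" .
  moreover have "fps_nth (infprod F) n = fps_nth (\<Prod>j<N. F j) n"
    using F by (intro infprod_nth) (auto simp: N_def)
  moreover have "fps_nth (F i * (\<Prod>j<N. (F(i := 1)) j)) n = fps_nth (F i * infprod (F(i := 1))) n"
    unfolding fps_mult_nth using F'
    by (intro sum.cong arg_cong2[where f = "(*)"] infprod_nth[symmetric]) (auto simp: N_def)
  ultimately show "fps_nth (infprod F) n = fps_nth (F i * infprod (F(i := 1))) n" by simp
qed

lemma infprod_in_Hinf:
  assumes F: "\<And>j. one_upto (Suc j) (F j)" "\<And>j. F j \<in> Hinf av" "\<And>j. Hinf_norm av (F j) \<le> M j"
    and M: "\<And>N. (\<Prod>j<N. M j) \<le> C"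
  shows "infprod F \<in> Hinf av" "Hinf_norm av (infprod F) \<le> C"
proof -
  have prod: "(\<Prod>j<N. F j) \<in> Hinf av \<and> Hinf_norm av (\<Prod>j<N. F j) \<le> (\<Prod>j<N. M j)" for N
  proof (induction N)
    case (Suc N)
    have "Hinf_norm av ((\<Prod>j<N. F j) * F N) \<le> Hinf_norm av (\<Prod>j<N. F j) * Hinf_norm av (F N)"
      using Suc F by (intro Hinf_norm_mult_le) auto
    also have "\<dots> \<le> (\<Prod>j<N. M j) * M N"
      using Suc F Hinf_norm_nonneg by (intro mult_mono) (auto intro!: order_trans[OF Hinf_norm_nonneg])
    finally show ?case using Suc F by (auto intro: Hinf_mult)
  qed (simp add: Hinf_1 Hinf_norm_1_le)
  have "av (fps_nth (infprod F) n) \<le> C" for n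
  proof -
    have "av (fps_nth (infprod F) n) = av (fps_nth (\<Prod>j<Suc n. F j) n)" by (simp add: infprod_def)
    also have "\<dots> \<le> Hinf_norm av (\<Prod>j<Suc n. F j)" using prod[of "Suc n"] by (intro av_coeff_le_norm) blast
    also have "\<dots> \<le> C" using prod[of "Suc n"] M[of "Suc n"] by linarith
    finally show ?thesis .
  qed
  thus "infprod F \<in> Hinf av" "Hinf_norm av (infprod F) \<le> C" using Hinf_normI by blast+
qed

text \<open>
  The function \<open>h\<close> is the product of damping factors for radii tending to \<open>1\<close>, with norms whose
  product converges. On a given disk a single factor already makes \<open>h\<close> small.
\<close>

lemma ex_vanishing_at_boundary:
  assumes f: "f \<in> Hinf av" and r: "0 < r" "r < Hinf_norm av f"
  shows "\<exists>h\<in>Hinf av. h \<noteq> 0 \<and> (\<forall>\<epsilon>>0. \<exists>R<1. \<forall>c s. R < av c \<and> av c < 1 \<and> 0 < s \<and> s < 1 \<and> zeta c s f \<le> r \<longrightarrow>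
    zeta c s h \<le> \<epsilon>)"
proof -
  define M :: "nat \<Rightarrow> real" where "M j = exp ((1/2) ^ j)" for j
  define good where "good j \<sigma> \<tau> H \<longleftrightarrow> H \<in> Hinf av \<and> one_upto (Suc j) H \<and> Hinf_norm av H \<le> M j \<and>
    (\<forall>c s. \<sigma> < av c \<and> av c \<le> \<tau> \<and> 0 < s \<and> s < 1 \<and> zeta c s f \<le> r \<longrightarrow> zeta c s H \<le> (1/2) ^ j)"
    for j \<sigma> \<tau> H
  have "\<exists>\<sigma>. 1 - 1 / real (Suc j) < \<sigma> \<and> \<sigma> < 1 \<and> (\<forall>\<tau><1. \<exists>H. good j \<sigma> \<tau> H)" for j
  proof -
    have "\<forall>\<^sub>F \<sigma> in at_left 1. \<forall>\<tau><1. \<exists>H. good j \<sigma> \<tau> H"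
      using eventually_ex_damping_factor[OF f r, of "(1/2) ^ j" "M j" "Suc j"]
      by (auto simp: good_def M_def Bex_def)
    moreover have "\<forall>\<^sub>F \<sigma> in at_left 1. \<sigma> \<in> {1 - 1 / real (Suc j)<..<1}"
      by (intro eventually_at_leftI[of "1 - 1 / real (Suc j)"]) auto
    ultimately have "\<forall>\<^sub>F \<sigma> in at_left 1. (\<forall>\<tau><1. \<exists>H. good j \<sigma> \<tau> H) \<and> \<sigma> \<in> {1 - 1 / real (Suc j)<..<1}"
      by (rule eventually_conj)
    from eventually_happens'[OF trivial_limit_at_left_real this] show ?thesis by auto
  qed
  hence "\<exists>\<sigma>. \<forall>j. 1 - 1 / real (Suc j) < \<sigma> j \<and> \<sigma> j < 1 \<and> (\<forall>\<tau><1. \<exists>H. good j (\<sigma> j) \<tau> H)"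
    by (intro choice allI)
  then obtain \<sigma> where "\<forall>j. 1 - 1 / real (Suc j) < \<sigma> j \<and> \<sigma> j < 1 \<and> (\<forall>\<tau><1. \<exists>H. good j (\<sigma> j) \<tau> H)"
    by (rule exE)
  hence \<sigma>: "\<And>j. 1 - 1 / real (Suc j) < \<sigma> j" "\<And>j. \<sigma> j < 1"
    "\<And>j \<tau>. \<tau> < 1 \<Longrightarrow> \<exists>H. good j (\<sigma> j) \<tau> H" by auto
  \<comment> \<open>Factor \<open>j\<close> is responsible for the centres in the annulus between
    \<open>\<sigma> j\<close> and \<open>\<sigma> (Suc j)\<close>; since \<open>\<sigma>\<close> tends
    to \<open>1\<close>, these annuli exhaust the disk near its boundary.\<close>
  have "\<exists>H. good j (\<sigma> j) (\<sigma> (Suc j)) H" for j using \<sigma>(2,3) by blast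
  hence "\<exists>F. \<forall>j. good j (\<sigma> j) (\<sigma> (Suc j)) (F j)" by (intro choice allI)
  then obtain F where good: "\<And>j. good j (\<sigma> j) (\<sigma> (Suc j)) (F j)" by (auto simp only:)
  have F: "\<And>j. F j \<in> Hinf av" "\<And>j. one_upto (Suc j) (F j)" "\<And>j. Hinf_norm av (F j) \<le> M j"
    using good by (auto simp: good_def)
  have M_le: "(\<Prod>j<N. M j) \<le> exp 2" for N
  proof -
    have "(\<Sum>j<N. (1/2) ^ j) \<le> (\<Sum>j. (1/2::real) ^ j)"
      by (intro sum_le_suminf) auto
    hence "(\<Sum>j<N. (1/2::real) ^ j) \<le> 2" by (simp add: suminf_geometric)
    thus ?thesis by (simp add: M_def flip: exp_sum)
  qed
  define h where "h = infprod F"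
  have h: "h \<in> Hinf av" unfolding h_def by (rule infprod_in_Hinf(1)[OF F(2,1,3) M_le])
  show ?thesis
  proof (intro bexI[OF _ h] conjI allI impI)
    show "h \<noteq> 0" using infprod_nth_0[OF F(2)] by (auto simp: h_def)
    fix \<epsilon> :: real assume "\<epsilon> > 0"
    then obtain J where J: "(1/2) ^ J < \<epsilon> / exp 2"
      using real_arch_pow_inv[of "\<epsilon> / exp 2" "1/2"] by auto
    show "\<exists>R<1. \<forall>c s. R < av c \<and> av c < 1 \<and> 0 < s \<and> s < 1 \<and> zeta c s f \<le> r \<longrightarrow> zeta c s h \<le> \<epsilon>"
    proof (intro exI[of _ "\<sigma> J"] conjI allI impI \<sigma>)
      fix c s assume "\<sigma> J < av c \<and> av c < 1 \<and> 0 < s \<and> s < 1 \<and> zeta c s f \<le> r"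
      hence c: "\<sigma> J < av c" "av c < 1" and s: "0 < s" "s < 1" "zeta c s f \<le> r" by auto
      have cu: "c \<in> unit_disk av" using c by (simp add: unit_disk_def)
      obtain n0 where n0: "1 / real (Suc n0) < 1 - av c"
        using reals_Archimedean[of "1 - av c"] c by (auto simp: inverse_eq_divide)
      define n where "n = max n0 J"
      have "1 / real (Suc n) \<le> 1 / real (Suc n0)" by (intro divide_left_mono) (auto simp: n_def)
      hence "av c \<le> \<sigma> n" using n0 \<sigma>(1)[of n] by linarith
      hence ex: "J \<le> n \<and> av c \<le> \<sigma> n" by (simp add: n_def)
      define k where "k = (LEAST k. J \<le> k \<and> av c \<le> \<sigma> k)"
      have k: "J \<le> k \<and> av c \<le> \<sigma> k" unfolding k_def using ex by (rule LeastI)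
      have "k \<noteq> J" using k c by auto
      then obtain m where m: "k = Suc m" "J \<le> m" using k by (cases k) auto
      have "\<not> (J \<le> m \<and> av c \<le> \<sigma> m)" using not_less_Least[of m "\<lambda>k. J \<le> k \<and> av c \<le> \<sigma> k"] m(1)
        unfolding k_def by simp
      hence "\<sigma> m < av c" using m by simp
      hence "zeta c s (F m) \<le> (1/2) ^ m"
        using good[of m] k m c s by (auto simp: good_def)
      also have "\<dots> \<le> (1/2) ^ J" using m by (intro power_decreasing) auto
      finally have Fm: "zeta c s (F m) \<le> (1/2) ^ J" .
      define g where "g = infprod (F(m := 1))"
      have "1 \<le> M m" by (simp add: M_def)
      hence F': "one_upto (Suc j) ((F(m := 1)) j)" "(F(m := 1)) j \<in> Hinf av"
        "Hinf_norm av ((F(m := 1)) j) \<le> M j" for j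
        using F[of j] Hinf_norm_1_le by (auto simp: Hinf_1 one_upto_def)
      have g: "g \<in> Hinf av" "Hinf_norm av g \<le> exp 2"
        unfolding g_def using infprod_in_Hinf[OF F' M_le] by blast+
      have "h = F m * g" unfolding h_def g_def using F(2) by (rule infprod_remove_factor)
      hence "zeta c s h = zeta c s (F m) * zeta c s g"
        using F g cu s by (simp add: zeta_mult)
      also have "\<dots> \<le> (1/2) ^ J * exp 2"
        using Fm zeta_le_norm[OF g(1) cu s(1,2)] g(2) zeta_nonneg[OF g(1) cu s(1,2)]
        by (intro mult_mono) auto
      also have "\<dots> \<le> \<epsilon>" using J by (simp add: field_simps)
      finally show "zeta c s h \<le> \<epsilon>" .
    qed
  qed
qed

section \<open>The Berkovich space\<close>

lemma BerkD:
  assumes "\<phi> \<in> Berk av"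
  shows "\<And>f. f \<in> Hinf av \<Longrightarrow> 0 \<le> \<phi> f" "\<phi> 0 = 0" "\<phi> 1 = 1"
    "\<And>f g. f \<in> Hinf av \<Longrightarrow> g \<in> Hinf av \<Longrightarrow> \<phi> (f * g) = \<phi> f * \<phi> g"
    "\<And>f g. f \<in> Hinf av \<Longrightarrow> g \<in> Hinf av \<Longrightarrow> \<phi> (f + g) \<le> \<phi> f + \<phi> g"
    "\<And>f. f \<in> Hinf av \<Longrightarrow> \<phi> f \<le> Hinf_norm av f"
  using assms by (auto simp: Berk_def)

lemma limitin_Berk_iff:
  assumes "\<And>n. X n \<in> Berk av"
  shows "limitin (Berk_topology av) X \<psi> u \<longleftrightarrow>
    \<psi> \<in> Berk av \<and> (\<forall>g\<in>Hinf av. ((\<lambda>n. X n g) \<longlongrightarrow> \<psi> g) u)"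
proof -
  have "\<phi> \<in> extensional (Hinf av)" if "\<phi> \<in> Berk av" for \<phi>
    using that by (auto simp: Berk_def PiE_def)
  thus ?thesis using assms
    unfolding Berk_topology_def limitin_subtopology limitin_componentwise
    by (auto simp: PiE_def)
qed

text \<open>
  This is the compactness of the Berkovich space, in the form in which it is used: the values at a fixed
  series stay between \<open>0\<close> and its norm, and the defining conditions are closed.
\<close>

lemma ultrafilter_limit_in_Berk:
  assumes u: "ultrafilter u" and X: "\<And>n. X n \<in> Berk av"
  shows "\<exists>\<psi>. limitin (Berk_topology av) X \<psi> u"
proof -
  have ne: "u \<noteq> bot" using u by (simp add: ultrafilter_def)
  have "\<exists>l. ((\<lambda>n. X n g) \<longlongrightarrow> l) u" if "g \<in> Hinf av" for g
    using BerkD[OF X] that by (intro ultrafilter_tendsto[OF u, of _ 0 "Hinf_norm av g"]) auto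
  then obtain L where L: "\<And>g. g \<in> Hinf av \<Longrightarrow> ((\<lambda>n. X n g) \<longlongrightarrow> L g) u" by metis
  define \<psi> where "\<psi> = restrict L (Hinf av)"
  have \<psi>: "((\<lambda>n. X n g) \<longlongrightarrow> \<psi> g) u" if "g \<in> Hinf av" for g
    using L[OF that] that by (simp add: \<psi>_def)
  have "\<psi> \<in> Berk av"
    unfolding Berk_def mem_Collect_eq
  proof (intro conjI ballI PiE_I)
    fix g assume g: "g \<in> Hinf av"
    show "\<psi> g \<in> {0..}"
      using tendsto_lowerbound[OF \<psi>[OF g] _ ne, of 0] BerkD(1)[OF X g] by simp
    show "\<psi> g \<le> Hinf_norm av g"
      using tendsto_upperbound[OF \<psi>[OF g] _ ne, of "Hinf_norm av g"] BerkD(6)[OF X g] by simp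
    fix h assume h: "h \<in> Hinf av"
    show "\<psi> (g * h) = \<psi> g * \<psi> h"
    proof (rule tendsto_unique[OF ne])
      show "((\<lambda>n. X n (g * h)) \<longlongrightarrow> \<psi> (g * h)) u" using g h by (intro \<psi> Hinf_mult)
      show "((\<lambda>n. X n (g * h)) \<longlongrightarrow> \<psi> g * \<psi> h) u"
        using tendsto_mult[OF \<psi>[OF g] \<psi>[OF h]] BerkD(4)[OF X g h] by simp
    qed
    show "\<psi> (g + h) \<le> \<psi> g + \<psi> h"
    proof (rule tendsto_le[OF ne])
      show "((\<lambda>n. X n (g + h)) \<longlongrightarrow> \<psi> (g + h)) u" using g h by (intro \<psi> Hinf_add)
      show "((\<lambda>n. X n g + X n h) \<longlongrightarrow> \<psi> g + \<psi> h) u" using g h by (intro tendsto_add \<psi>)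
      show "\<forall>\<^sub>F n in u. X n (g + h) \<le> X n g + X n h" using BerkD(5)[OF X g h] by simp
    qed
  next
    show "\<psi> 0 = 0" using tendsto_unique[OF ne \<psi>[OF Hinf_0]] BerkD(2)[OF X] by simp
    show "\<psi> 1 = 1" using tendsto_unique[OF ne \<psi>[OF Hinf_1]] BerkD(3)[OF X] by simp
  qed (simp add: \<psi>_def)
  thus ?thesis using \<psi> limitin_Berk_iff[of X \<psi> u, OF X] by auto
qed

lemma ideal_seminorm_kernel:
  assumes "\<phi> \<in> Berk av"
  shows "ideal (seminorm_kernel av \<phi>) (Hinf_ring av)"
proof -
  interpret R: cring "Hinf_ring av" by (rule cring_Hinf)
  note \<phi> = BerkD[OF assms]
  have minus: "\<ominus>\<^bsub>Hinf_ring av\<^esub> f = - f" if "f \<in> Hinf av" for f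
    using that by (intro R.minus_equality) (auto simp: Hinf_ring_def Hinf_uminus)
  have ker_uminus: "- f \<in> seminorm_kernel av \<phi>" if "f \<in> seminorm_kernel av \<phi>" for f
  proof -
    have "\<phi> (- 1 * f) = \<phi> (- 1) * \<phi> f"
      using that by (intro \<phi>) (auto simp: seminorm_kernel_def Hinf_1 Hinf_uminus)
    thus ?thesis using that by (simp add: seminorm_kernel_def Hinf_uminus)
  qed
  have ker_add: "f + g \<in> seminorm_kernel av \<phi>"
    if "f \<in> seminorm_kernel av \<phi>" "g \<in> seminorm_kernel av \<phi>" for f g
    using that \<phi>(5)[of f g] \<phi>(1)[of "f + g"] by (auto simp: seminorm_kernel_def Hinf_add)
  show ?thesis
  proof (rule idealI[OF R.ring_axioms])
    show "subgroup (seminorm_kernel av \<phi>) (add_monoid (Hinf_ring av))"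
    proof (rule R.add.subgroupI)
      show "\<ominus>\<^bsub>Hinf_ring av\<^esub> f \<in> seminorm_kernel av \<phi>"
        if "f \<in> seminorm_kernel av \<phi>" for f
        using minus[of f] ker_uminus[OF that] that by (simp add: seminorm_kernel_def)
      have "0 \<in> seminorm_kernel av \<phi>" using \<phi>(2) by (simp add: seminorm_kernel_def Hinf_0)
      thus "seminorm_kernel av \<phi> \<noteq> {}" by blast
      show "f \<oplus>\<^bsub>Hinf_ring av\<^esub> g \<in> seminorm_kernel av \<phi>"
        if "f \<in> seminorm_kernel av \<phi>" "g \<in> seminorm_kernel av \<phi>" for f g
        using ker_add[OF that] by (simp add: Hinf_ring_def)
    qed (auto simp: Hinf_ring_def seminorm_kernel_def)
  qed (auto simp: Hinf_ring_def seminorm_kernel_def Hinf_mult \<phi>)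
qed

text \<open>
  The kernel of the smaller seminorm is a proper ideal and strictly larger.
\<close>

lemma kernel_not_maximal:
  assumes \<phi>: "\<phi> \<in> Berk av" and \<psi>: "\<psi> \<in> Berk av" and le: "\<And>g. g \<in> Hinf av \<Longrightarrow> \<phi> g \<le> \<psi> g"
    and f: "f \<in> seminorm_kernel av \<phi>" "f \<notin> seminorm_kernel av \<psi>"
  shows "\<not> maximalideal (seminorm_kernel av \<psi>) (Hinf_ring av)"
proof
  assume "maximalideal (seminorm_kernel av \<psi>) (Hinf_ring av)"
  then interpret maximalideal "seminorm_kernel av \<psi>" "Hinf_ring av" .
  have "seminorm_kernel av \<psi> \<subseteq> seminorm_kernel av \<phi>"
    using le BerkD(1)[OF \<phi>] by (fastforce simp: seminorm_kernel_def)
  moreover have "seminorm_kernel av \<phi> \<subseteq> carrier (Hinf_ring av)"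
    by (auto simp: seminorm_kernel_def Hinf_ring_def)
  ultimately have "seminorm_kernel av \<phi> = seminorm_kernel av \<psi> \<or> seminorm_kernel av \<phi> = carrier (Hinf_ring av)"
    using ideal_seminorm_kernel[OF \<phi>] by (intro I_maximal)
  moreover have "1 \<notin> seminorm_kernel av \<phi>" using BerkD(3)[OF \<phi>] by (simp add: seminorm_kernel_def)
  moreover have "1 \<in> carrier (Hinf_ring av)" by (simp add: Hinf_ring_def Hinf_1)
  ultimately show False using f by blast
qed

section \<open>A larger seminorm with a prescribed value\<close>

lemma finite_indices_in_disk:
  assumes z: "(\<lambda>n. av (z n)) \<longlonglongrightarrow> 1" and c: "c \<in> unit_disk av" "s < 1"
  shows "finite {n. z n \<in> closed_disk av c s}"
proof -
  have "max (av c) s < 1" using c by (auto simp: unit_disk_def)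
  hence "\<forall>\<^sub>F n in sequentially. max (av c) s < av (z n)" using z by (intro order_tendstoD)
  then obtain N where N: "\<And>n. n \<ge> N \<Longrightarrow> max (av c) s < av (z n)" by (auto simp: eventually_sequentially)
  have "n < N" if "z n \<in> closed_disk av c s" for n
    using N[of n] av_le_if_mem_closed_disk[OF that] by (meson not_less)
  hence "{n. z n \<in> closed_disk av c s} \<subseteq> {..<N}" by auto
  thus ?thesis by (rule finite_subset) simp
qed

theorem ex_larger_seminorm_with_value:
  assumes \<phi>: "\<phi> \<in> Berk0 av" and f: "f \<in> seminorm_kernel av \<phi>" and r: "0 < r" "r < Hinf_norm av f"
  shows "\<exists>\<psi> \<in> Berk0' av. ideal (seminorm_kernel av \<psi>) (Hinf_ring av) \<and> seminorm_kernel av \<psi> \<noteq> {0} \<and>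
    \<not> maximalideal (seminorm_kernel av \<psi>) (Hinf_ring av) \<and> (\<forall>g \<in> Hinf av. \<phi> g \<le> \<psi> g) \<and> \<psi> f = r"
proof -
  obtain u z t where data: "disk_limit_data av u z t \<phi>" using \<phi> by (auto simp: Berk0_def)
  have fH: "f \<in> Hinf av" and f0: "\<phi> f = 0" using f by (auto simp: seminorm_kernel_def)
  have u: "nonprincipal_ultrafilter u" and z: "\<And>n. z n \<in> unit_disk av" and z1: "(\<lambda>n. av (z n)) \<longlonglongrightarrow> 1"
    and t: "\<And>n. 0 < t n" "\<And>n. t n < 1"
    and lim: "limitin (Berk_topology av) (\<lambda>n. disk_seminorm av (closed_disk av (z n) (t n))) \<phi> u"
    using data by (auto simp: disk_limit_data_def)
  have ne: "u \<noteq> bot" using u by (simp add: nonprincipal_ultrafilter_def ultrafilter_def)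
  have \<phi>B: "\<phi> \<in> Berk av" and \<phi>_lim: "\<And>g. g \<in> Hinf av \<Longrightarrow> ((\<lambda>n. zeta (z n) (t n) g) \<longlongrightarrow> \<phi> g) u"
    using lim limitin_Berk_iff[of "\<lambda>n. disk_seminorm av (closed_disk av (z n) (t n))" \<phi> u]
      disk_seminorm_in_Berk[OF z t] by (auto simp: disk_seminorm_eq_zeta)

  define A where "A = {n. zeta (z n) (t n) f < r}"
  have A: "\<forall>\<^sub>F n in u. n \<in> A"
    using order_tendstoD(2)[OF \<phi>_lim[OF fH], of r] f0 r by (simp add: A_def)
  have "\<exists>s. t n \<le> s \<and> maximal_radius f r (z n) s" if "n \<in> A" for n
    using ex_maximal_radius[OF fH z t _ r] that by (auto simp: A_def)
  then obtain s' where s': "\<And>n. n \<in> A \<Longrightarrow> t n \<le> s' n" "\<And>n. n \<in> A \<Longrightarrow> maximal_radius f r (z n) (s' n)"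
    by metis
  \<comment> \<open>The radius \<open>1 / 2\<close> outside \<open>A\<close> is arbitrary: these indices
    are negligible for \<open>u\<close>.\<close>
  define s where "s n = (if n \<in> A then s' n else 1 / 2)" for n
  have s_A: "t n \<le> s n" "maximal_radius f r (z n) (s n)" if "n \<in> A" for n
    using s' that by (auto simp: s_def)
  have s: "0 < s n" "s n < 1" for n
    using s_A[of n] by (auto simp: s_def maximal_radius_def)
  define D where "D n = closed_disk av (z n) (s n)" for n

  have "finite {n \<in> A. D n = D m}" for m
  proof (rule finite_subset)
    show "{n \<in> A. D n = D m} \<subseteq> {n. z n \<in> closed_disk av (z m) (s m)}"
      using centre_in_closed_disk[of "s _" "z _"] s by (fastforce simp: D_def less_imp_le)
    show "finite {n. z n \<in> closed_disk av (z m) (s m)}"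
      using z1 z[of m] s(2)[of m] by (rule finite_indices_in_disk)
  qed
  moreover have "D m = D n" if "m \<in> A" "n \<in> A" "D m \<inter> D n \<noteq> {}" for m n
    unfolding D_def using s_A that by (intro maximal_radius_disks_equal(2)) (auto simp: D_def)
  ultimately obtain p C where v: "nonprincipal_ultrafilter (filtermap p u)" and C: "C \<subseteq> A"
    and evC: "\<forall>\<^sub>F n in filtermap p u. n \<in> C"
    and Dp: "\<forall>n\<in>A. D (p n) = D n" and disj: "disjoint_family_on D C"
    using disjoint_reindexing[OF u A, of D] by blast

  define X where "X n = disk_seminorm av (D n)" for n
  have X: "X n \<in> Berk av" for n unfolding X_def D_def by (intro disk_seminorm_in_Berk z s)
  have "ultrafilter (filtermap p u)" using v by (simp add: nonprincipal_ultrafilter_def)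
  then obtain \<psi> where \<psi>: "limitin (Berk_topology av) X \<psi> (filtermap p u)"
    using ultrafilter_limit_in_Berk[of _ X, OF _ X] by blast
  have \<psi>B: "\<psi> \<in> Berk av" using \<psi> limitin_Berk_iff[of X \<psi> "filtermap p u", OF X] by blast
  have \<psi>_lim: "((\<lambda>n. zeta (z n) (s n) g) \<longlongrightarrow> \<psi> g) u" if g: "g \<in> Hinf av" for g
  proof -
    have "((\<lambda>n. X n g) \<longlongrightarrow> \<psi> g) (filtermap p u)"
      using \<psi> limitin_Berk_iff[of X \<psi> "filtermap p u", OF X] g by blast
    hence "((\<lambda>n. X (p n) g) \<longlongrightarrow> \<psi> g) u" by (simp add: filterlim_filtermap)
    moreover have "\<forall>\<^sub>F n in u. X (p n) g = zeta (z n) (s n) g"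
      using A by eventually_elim (use Dp g in \<open>simp add: X_def D_def disk_seminorm_eq_zeta\<close>)
    ultimately show ?thesis by (simp cong: tendsto_cong)
  qed
  have \<psi>f: "\<psi> f = r"
  proof (rule tendsto_unique[OF ne \<psi>_lim[OF fH]])
    have "\<forall>\<^sub>F n in u. zeta (z n) (s n) f = r"
      using A by eventually_elim (use s_A in \<open>auto simp: maximal_radius_def\<close>)
    thus "((\<lambda>n. zeta (z n) (s n) f) \<longlongrightarrow> r) u" by (rule tendsto_eventually)
  qed
  have le: "\<phi> g \<le> \<psi> g" if g: "g \<in> Hinf av" for g
  proof (rule tendsto_le[OF ne \<psi>_lim[OF g] \<phi>_lim[OF g]])
    show "\<forall>\<^sub>F n in u. zeta (z n) (t n) g \<le> zeta (z n) (s n) g"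
      using A by eventually_elim (use s_A s t z g in \<open>auto intro!: zeta_mono closed_disk_mono\<close>)
  qed

  \<comment> \<open>The disks tend to the boundary and \<open>f\<close> is at most \<open>r\<close> on
    them, so \<open>h\<close> tends to \<open>0\<close> along them.\<close>
  obtain h where h: "h \<in> Hinf av" "h \<noteq> 0"
    "\<And>\<epsilon>. 0 < \<epsilon> \<Longrightarrow> \<exists>R<1. \<forall>c s. R < av c \<and> av c < 1 \<and> 0 < s \<and> s < 1 \<and> zeta c s f \<le> r \<longrightarrow> zeta c s h \<le> \<epsilon>"
    using ex_vanishing_at_boundary[OF fH r] by blast
  have "\<psi> h \<le> 0"
  proof (rule field_le_epsilon)
    fix \<epsilon> :: real assume "0 < \<epsilon>"
    then obtain R where R: "R < 1" "\<And>c s. \<lbrakk>R < av c; av c < 1; 0 < s; s < 1; zeta c s f \<le> r\<rbrakk> \<Longrightarrow> zeta c s h \<le> \<epsilon>"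
      using h(3) by blast
    have "\<forall>\<^sub>F n in sequentially. R < av (z n)" using z1 R(1) by (rule order_tendstoD)
    hence "\<forall>\<^sub>F n in u. R < av (z n)"
      using nonprincipal_ultrafilter_le_sequentially[OF u] by (rule filter_leD[rotated])
    hence "\<forall>\<^sub>F n in u. zeta (z n) (s n) h \<le> \<epsilon>"
      using A
    proof eventually_elim
      case (elim n)
      thus ?case using z[of n] s[of n] s_A(2)[of n]
        by (intro R(2)) (auto simp: unit_disk_def maximal_radius_def)
    qed
    thus "\<psi> h \<le> 0 + \<epsilon>" using tendsto_upperbound[OF \<psi>_lim[OF h(1)] _ ne] by simp
  qed
  hence "h \<in> seminorm_kernel av \<psi>" using BerkD(1)[OF \<psi>B h(1)] h(1) by (simp add: seminorm_kernel_def)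
  hence ker: "seminorm_kernel av \<psi> \<noteq> {0}" using h(2) by blast

  have "C \<noteq> {}"
  proof
    assume "C = {}"
    hence "\<forall>\<^sub>F n in filtermap p u. False" using evC by simp
    thus False using ne by (simp add: eventually_False filtermap_bot_iff)
  qed
  have sep: "r / Hinf_norm av f \<le> separation av z C n" if "n \<in> C" for n
  proof (rule separation_ge[OF fH r(1) _ z _ disj[unfolded D_def] that])
    show "0 < Hinf_norm av f" using r by simp
    show "maximal_radius f r (z m) (s m)" if "m \<in> C" for m using s_A(2) C that by blast
  qed
  have "0 < r / Hinf_norm av f" using r by simp
  also have "\<dots> \<le> (INF n\<in>C. separation av z C n)" using \<open>C \<noteq> {}\<close> sep by (rule cINF_greatest)
  finally have "regular_wrt av z (filtermap p u)" unfolding regular_wrt_def using evC by blast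
  moreover have "disk_limit_data av (filtermap p u) z s \<psi>"
    using v z z1 s \<psi> by (simp add: disk_limit_data_def X_def[abs_def] D_def[abs_def])
  ultimately have "\<psi> \<in> Berk0' av"
    unfolding Berk0'_def using evC disj by (auto simp: D_def[abs_def])
  moreover have "f \<notin> seminorm_kernel av \<psi>" using \<psi>f r by (simp add: seminorm_kernel_def)
  hence "\<not> maximalideal (seminorm_kernel av \<psi>) (Hinf_ring av)"
    using le f by (intro kernel_not_maximal[OF \<phi>B \<psi>B]) auto
  ultimately show ?thesis using ideal_seminorm_kernel[OF \<psi>B] ker le \<psi>f by blast
qed

end

theorem theorem2p1:
  fixes av :: "'k::alg_closed_field \<Rightarrow> real"
    and \<phi> :: "'k fps \<Rightarrow> real"
    and f :: "'k fps"
    and r :: real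
  assumes "complete_nonarch_field av"
    and "\<phi> \<in> Berk0 av"
    and "seminorm_kernel av \<phi> \<noteq> {0}"
    and "f \<in> seminorm_kernel av \<phi>"
    and "f \<noteq> 0"
    and "0 < r"
    and "r < Hinf_norm av f"
  shows "\<exists>\<psi> \<in> Berk0' av.
           ideal (seminorm_kernel av \<psi>) (Hinf_ring av) \<and>
           seminorm_kernel av \<psi> \<noteq> {0} \<and>
           \<not> maximalideal (seminorm_kernel av \<psi>) (Hinf_ring av) \<and>
           (\<forall>g \<in> Hinf av. \<phi> g \<le> \<psi> g) \<and>
           \<psi> f = r"
  using complete_nonarch_field.ex_larger_seminorm_with_value[OF assms(1,2,4,6,7)] .

end
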